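(* Let the preorder $P$ conform to the submodular function $z:\mathcal P(I)\to\hat{\mathbb R}$ on a finite set $I$. The extended generalized permutahedron $\Pi(z^P)$ is a translated cone of dimension $|I|-|\mathbf c(P)|$, the same as the dimension of $\Pi(z)$. The lineality subspace of $\Pi(z^P)$ is the affine linear space spanned by the face $\Pi(z_P)$ of $\Pi(z)$.
   Context: $\hat{\mathbb R}=\mathbb R\cup\{\infty\}$. A function $z:\mathcal P(I)\to\hat{\mathbb R}$ with $z(\emptyset)=0$, $z(I)<\infty$ is submodular if $z(A\cup B)+z(A\cap B)\le z(A)+z(B)$ for all $A,B\subseteq I$. For $A\subseteq B\subseteq I$ with $z(A),z(B)<\infty$, $z_{B/A}(U)=z(A\cup U)-z(A)$ for $U\subseteq B\setminus A$. Product of functions on disjoint sets: $(u\cdot v)(E)=u(E\cap S)+v(E\cap T)$ for $E\subseteq S\sqcup T$. $z'$ on $\mathcal P(C)$ decomposes along $C=C_1\sqcup C_2$ if $z'(E)=z'(E\cap C_1)+z'(E\cap C_2)$ for all $E\subseteq C$. A preorder is a reflexive transitive relation; bubbles are the classes of $x\sim y\Leftrightarrow x\le_Py\le_Px$; $\mathbf c(P)$ is the set of connected components of $P$ (classes of the equivalence relation generated by $\le_P$); down-sets contain everything below their elements; convex subsets are $C=B\setminus A$ with $A\subseteq B$ down-sets; $C=C_1\sqcup C_2$ is a disconnected union if no element of $C_1$ is comparable to one of $C_2$. $P$ is compatible with $z$ if $z(A)<\infty$ for all down-sets $A$, and for down-sets $A\subseteq B$ with $B\setminus A=C_1\sqcup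 C_2$ a disconnected union, $z_{B/A}$ decomposes along $C_1\sqcup C_2$; then $z_{B/A}$ depends only on $C=B\setminus A$ and is written $z_C$. $P$ conforms to $z$ if moreover, for convex $C$, a decomposition of $z_C$ along $C=C_1\sqcup C_2$ implies that $C=C_1\sqcup C_2$ is a disconnected union in $P$. For $P$ compatible with $z$: $z_P=\prod_{C\text{ bubble of }P}z_C$; $z^P(A)=z(A)$ if $A$ is a down-set of $P$, and $z^P(A)=\infty$ otherwise. For $x\in\mathbb RI$, $x_A=\sum_{i\in A}x_i$, and for submodular $w$ on $I$, $\Pi(w)=\{x\in\mathbb RI:x_I=w(I),\ x_A\le w(A)\text{ whenever }w(A)<\infty\}$. $\Pi(z_P)$ is the face $\{x\in\Pi(z):x_A=z(A)\text{ for all down-sets }A\text{ of }P\}$ of $\Pi(z)$. A translated cone is a set $u+K$ with $K$ a polyhedral cone; its lineality subspace is the affine space $u+(K\cap(-K))$. *)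

theory Defs
  imports "HOL-Analysis.Analysis"
begin

text \<open>
  The finite ground set is a set \<open>I\<close> of elements of a finite type \<open>'i\<close>, so that \<open>I = {}\<close> is
  covered too, and \<open>\<real>I\<close> is the space of vectors in \<open>real ^ 'i\<close> supported on \<open>I\<close>.
  The extended reals \<open>\<real> \<union> {\<infinity>}\<close> are rendered by \<^typ>\<open>ereal\<close> together with an explicit
  exclusion of \<open>-\<infinity>\<close>. Set functions are total; only their values on \<open>Pow I\<close> (or on the
  power set of the set they live on) are ever relevant.
\<close>

subsection \<open>Submodular functions\<close>

definition submodular :: "'i set \<Rightarrow> ('i set \<Rightarrow> ereal) \<Rightarrow> bool" where
  "submodular I z \<longleftrightarrow>
     (\<forall>A\<subseteq>I. z A \<noteq> -\<infinity>) \<and> z {} = 0 \<and> z I < \<infinity> \<and>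
     (\<forall>A\<subseteq>I. \<forall>B\<subseteq>I. z (A \<union> B) + z (A \<inter> B) \<le> z A + z B)"

text \<open>\<open>minor z A\<close> is \<open>z\<^bsub>B/A\<^esub>\<close>; the set \<open>B\<close> only determines the domain \<open>Pow (B - A)\<close>.\<close>

definition minor :: "('i set \<Rightarrow> ereal) \<Rightarrow> 'i set \<Rightarrow> 'i set \<Rightarrow> ereal" where
  "minor z A U = z (A \<union> U) - z A"

text \<open>Product of a family of functions \<open>u C\<close> on pairwise disjoint sets \<open>C \<in> \<C>\<close>.\<close>

definition setfun_prod :: "'i set set \<Rightarrow> ('i set \<Rightarrow> 'i set \<Rightarrow> ereal) \<Rightarrow> 'i set \<Rightarrow> ereal" where
  "setfun_prod \<C> u E = (\<Sum>C\<in>\<C>. u C (E \<inter> C))"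

definition decomposes :: "('i set \<Rightarrow> ereal) \<Rightarrow> 'i set \<Rightarrow> 'i set \<Rightarrow> 'i set \<Rightarrow> bool" where
  "decomposes z' C C1 C2 \<longleftrightarrow>
     C = C1 \<union> C2 \<and> C1 \<inter> C2 = {} \<and> (\<forall>E\<subseteq>C. z' E = z' (E \<inter> C1) + z' (E \<inter> C2))"

subsection \<open>Preorders, with \<open>(x, y) \<in> P\<close> meaning \<open>x \<le>\<^sub>P y\<close>\<close>

definition bubbles :: "'i set \<Rightarrow> 'i rel \<Rightarrow> 'i set set" where
  "bubbles I P = I // (P \<inter> P\<inverse>)"

text \<open>For a preorder on \<open>I\<close>, the relation \<open>(P \<union> P\<inverse>)\<^sup>+\<close> is reflexive on \<open>I\<close>, hence it is
  the equivalence relation on \<open>I\<close> generated by \<open>P\<close>.\<close>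

definition components_of :: "'i set \<Rightarrow> 'i rel \<Rightarrow> 'i set set" where
  "components_of I P = I // (P \<union> P\<inverse>)\<^sup>+"

definition down_set :: "'i set \<Rightarrow> 'i rel \<Rightarrow> 'i set \<Rightarrow> bool" where
  "down_set I P A \<longleftrightarrow> A \<subseteq> I \<and> (\<forall>x y. (x, y) \<in> P \<longrightarrow> y \<in> A \<longrightarrow> x \<in> A)"

definition convex_subset :: "'i set \<Rightarrow> 'i rel \<Rightarrow> 'i set \<Rightarrow> bool" where
  "convex_subset I P C \<longleftrightarrow> (\<exists>A B. down_set I P A \<and> down_set I P B \<and> A \<subseteq> B \<and> C = B - A)"

definition disconnected_union :: "'i rel \<Rightarrow> 'i set \<Rightarrow> 'i set \<Rightarrow> 'i set \<Rightarrow> bool" where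
  "disconnected_union P C C1 C2 \<longleftrightarrow>
     C = C1 \<union> C2 \<and> C1 \<inter> C2 = {} \<and> (\<forall>x\<in>C1. \<forall>y\<in>C2. (x, y) \<notin> P \<and> (y, x) \<notin> P)"

subsection \<open>Compatible and conforming preorders\<close>

definition compatible :: "'i set \<Rightarrow> ('i set \<Rightarrow> ereal) \<Rightarrow> 'i rel \<Rightarrow> bool" where
  "compatible I z P \<longleftrightarrow>
     (\<forall>A. down_set I P A \<longrightarrow> z A < \<infinity>) \<and>
     (\<forall>A B C1 C2. down_set I P A \<longrightarrow> down_set I P B \<longrightarrow> A \<subseteq> B \<longrightarrow>
        disconnected_union P (B - A) C1 C2 \<longrightarrow> decomposes (minor z A) (B - A) C1 C2)"

text \<open>\<open>zconv I z P C\<close> is \<open>z\<^sub>C\<close>, the common value of all \<open>z\<^bsub>B/A\<^esub>\<close> with \<open>C = B - A\<close> on subsets of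
  the convex set \<open>C\<close>; lemma \<open>zconv_eq\<close> shows that it is well defined.\<close>

definition zconv :: "'i set \<Rightarrow> ('i set \<Rightarrow> ereal) \<Rightarrow> 'i rel \<Rightarrow> 'i set \<Rightarrow> 'i set \<Rightarrow> ereal" where
  "zconv I z P C U =
     (THE v. \<exists>A B. down_set I P A \<and> down_set I P B \<and> A \<subseteq> B \<and> C = B - A \<and> v = minor z A U)"

definition conforms :: "'i set \<Rightarrow> ('i set \<Rightarrow> ereal) \<Rightarrow> 'i rel \<Rightarrow> bool" where
  "conforms I z P \<longleftrightarrow>
     compatible I z P \<and>
     (\<forall>C C1 C2. convex_subset I P C \<longrightarrow> decomposes (zconv I z P C) C C1 C2 \<longrightarrow>
        disconnected_union P C C1 C2)"

lemma minor_eq_mono: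
  assumes z: "submodular I z" and c: "compatible I z P"
    and d: "down_set I P A" "down_set I P B" "down_set I P A'" "down_set I P B'"
    and sub: "A \<subseteq> B" "A' \<subseteq> B'" "B - A = B' - A'" "A \<subseteq> A'" and U: "U \<subseteq> B - A"
  shows "minor z A U = minor z A' U"
proof -
  have "disconnected_union P (B' - A) (B - A) (A' - A)"
    using d sub unfolding disconnected_union_def down_set_def by blast
  then have dec: "decomposes (minor z A) (B' - A) (B - A) (A' - A)"
    using c d sub unfolding compatible_def by (meson order_trans)
  have eqs: "(U \<union> (A' - A)) \<inter> (B - A) = U" "(U \<union> (A' - A)) \<inter> (A' - A) = A' - A"
    "A \<union> (U \<union> (A' - A)) = A' \<union> U" "A \<union> (A' - A) = A'"
    using sub U by blast+
  have "U \<union> (A' - A) \<subseteq> B' - A" using sub U by blast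
  with dec have "minor z A (U \<union> (A' - A)) = minor z A U + minor z A (A' - A)"
    unfolding decomposes_def using eqs by metis
  then have *: "z (A' \<union> U) - z A = (z (A \<union> U) - z A) + (z A' - z A)"
    by (simp only: minor_def eqs)
  have "z A < \<infinity>" "z A' < \<infinity>" using c d unfolding compatible_def by blast+
  moreover have "A \<subseteq> I" "A' \<subseteq> I" "A \<union> U \<subseteq> I" "A' \<union> U \<subseteq> I"
    using d U unfolding down_set_def by blast+
  then have "z A \<noteq> -\<infinity>" "z A' \<noteq> -\<infinity>" "z (A \<union> U) \<noteq> -\<infinity>" "z (A' \<union> U) \<noteq> -\<infinity>"
    using z unfolding submodular_def by blast+
  ultimately show ?thesis
    using * unfolding minor_def
    by (cases "z A"; cases "z A'"; cases "z (A \<union> U)"; cases "z (A' \<union> U)") auto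
qed

lemma zconv_eq:
  assumes z: "submodular I z" and c: "compatible I z P"
    and d: "down_set I P A" "down_set I P B" "A \<subseteq> B" and U: "U \<subseteq> B - A"
  shows "zconv I z P (B - A) U = minor z A U"
  unfolding zconv_def
proof (rule the_equality)
  fix v assume "\<exists>A' B'. down_set I P A' \<and> down_set I P B' \<and> A' \<subseteq> B' \<and> B - A = B' - A' \<and>
    v = minor z A' U"
  then obtain A' B' where d': "down_set I P A'" "down_set I P B'" "A' \<subseteq> B'"
    and e: "B - A = B' - A'" and v: "v = minor z A' U" by blast
  have u: "down_set I P (A \<union> A')" "down_set I P (B \<union> B')"
    using d d' unfolding down_set_def by blast+
  have "A \<union> A' \<subseteq> B \<union> B'" "B - A = (B \<union> B') - (A \<union> A')" "B' - A' = (B \<union> B') - (A \<union> A')"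
    using d(3) d'(3) e by blast+
  then show "v = minor z A U"
    using minor_eq_mono[OF z c d(1,2) u d(3) _ _ _ U]
      minor_eq_mono[OF z c d'(1,2) u d'(3) _ _ _] U e v by auto
qed (use d in blast)

subsection \<open>The functions \<open>z\<^sub>P\<close> and \<open>z\<^sup>P\<close>\<close>

definition z_lower :: "'i set \<Rightarrow> ('i set \<Rightarrow> ereal) \<Rightarrow> 'i rel \<Rightarrow> 'i set \<Rightarrow> ereal" where
  "z_lower I z P = setfun_prod (bubbles I P) (zconv I z P)"

definition z_upper :: "'i set \<Rightarrow> ('i set \<Rightarrow> ereal) \<Rightarrow> 'i rel \<Rightarrow> 'i set \<Rightarrow> ereal" where
  "z_upper I z P A = (if down_set I P A then z A else \<infinity>)"

subsection \<open>Extended generalized permutahedra and translated cones\<close>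

definition perm_polyhedron :: "'i::finite set \<Rightarrow> ('i set \<Rightarrow> ereal) \<Rightarrow> (real ^ 'i) set" where
  "perm_polyhedron I w =
     {x. (\<forall>i. i \<notin> I \<longrightarrow> x $ i = 0) \<and> ereal (\<Sum>i\<in>I. x $ i) = w I \<and>
         (\<forall>A\<subseteq>I. w A < \<infinity> \<longrightarrow> ereal (\<Sum>i\<in>A. x $ i) \<le> w A)}"

text \<open>The library's \<^const>\<open>cone\<close> admits the empty set, which is not a polyhedral cone.\<close>

definition polyhedral_cone :: "'v::euclidean_space set \<Rightarrow> bool" where
  "polyhedral_cone K \<longleftrightarrow> polyhedron K \<and> cone K \<and> K \<noteq> {}"

definition translated_cone :: "'v::euclidean_space set \<Rightarrow> bool" where
  "translated_cone S \<longleftrightarrow> (\<exists>u K. polyhedral_cone K \<and> S = (+) u ` K)"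

text \<open>Lemma \<open>lineality_subspace_eq\<close> shows independence of the choice of \<open>u\<close> and \<open>K\<close>.\<close>

definition lineality_subspace :: "'v::euclidean_space set \<Rightarrow> 'v set" where
  "lineality_subspace S =
     (THE L. \<exists>u K. polyhedral_cone K \<and> S = (+) u ` K \<and> L = (+) u ` (K \<inter> uminus ` K))"

lemma lineality_subspace_eq:
  fixes K :: "'v::euclidean_space set"
  assumes K: "polyhedral_cone K"
  shows "lineality_subspace ((+) u ` K) = (+) u ` (K \<inter> uminus ` K)"
  unfolding lineality_subspace_def
proof (rule the_equality)
  fix L assume "\<exists>u' K'. polyhedral_cone K' \<and> (+) u ` K = (+) u' ` K' \<and>
    L = (+) u' ` (K' \<inter> uminus ` K')"
  then obtain u' K' where K': "polyhedral_cone K'" and e: "(+) u ` K = (+) u' ` K'"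
    and L: "L = (+) u' ` (K' \<inter> uminus ` K')" by blast
  have mem: "x \<in> K \<longleftrightarrow> x + (u - u') \<in> K'" for x
  proof -
    have "x \<in> K \<longleftrightarrow> u + x \<in> (+) u ` K" by auto
    also have "\<dots> \<longleftrightarrow> u + x \<in> (+) u' ` K'" by (simp only: e)
    also have "\<dots> \<longleftrightarrow> x + (u - u') \<in> K'"
      by (auto simp: image_iff algebra_simps)
        (metis add.commute add_diff_cancel_left' diff_add_eq)+
    finally show ?thesis .
  qed
  define d where "d = u - u'"
  have c: "cone K" "convex K" "0 \<in> K" "cone K'" "convex K'" "0 \<in> K'"
    using K K' unfolding polyhedral_cone_def
    using cone_contains_0 polyhedron_imp_convex by blast+
  have add: "x + y \<in> K" if "x \<in> K" "y \<in> K" for x y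
    using c that convex_cone[of K] by blast
  have add': "x + y \<in> K'" if "x \<in> K'" "y \<in> K'" for x y
    using c that convex_cone[of K'] by blast
  have dK': "d \<in> K'" using mem[of 0] c by (simp add: d_def)
  have "d + d \<in> K'" using add' dK' by blast
  then have dK: "d \<in> K" using mem[of d] by (simp add: d_def)
  have mdK: "- d \<in> K" using mem[of "-d"] c by (simp add: d_def)
  have KK': "K' = K"
  proof (intro set_eqI iffI)
    fix x assume "x \<in> K'"
    then have "x - d \<in> K" using mem[of "x - d"] by (simp add: d_def)
    then show "x \<in> K" using add[OF _ dK] by fastforce
  next
    fix x assume "x \<in> K"
    then have "x + - d \<in> K" using add mdK by blast
    then show "x \<in> K'" using mem[of "x + - d"] by (simp add: d_def)
  qed
  define M where "M = K \<inter> uminus ` K"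
  have M: "x \<in> M \<longleftrightarrow> x \<in> K \<and> - x \<in> K" for x
    unfolding M_def by (auto simp: image_iff) (metis minus_minus)
  have shift: "x + d \<in> M \<and> x - d \<in> M" if "x \<in> M" for x
    using that add[of x d] add[of x "-d"] add[of "-x" d] add[of "-x" "-d"] dK mdK
    unfolding M by (simp add: algebra_simps)
  show "L = (+) u ` (K \<inter> uminus ` K)"
    unfolding L KK' M_def[symmetric]
  proof (intro set_eqI iffI)
    fix y assume "y \<in> (+) u' ` M"
    then obtain x where "x \<in> M" "y = u' + x" by blast
    then have "x - d \<in> M" "y = u + (x - d)" using shift by (auto simp: d_def)
    then show "y \<in> (+) u ` M" by blast
  next
    fix y assume "y \<in> (+) u ` M"
    then obtain x where "x \<in> M" "y = u + x" by blast
    then have "x + d \<in> M" "y = u' + (x + d)" using shift by (auto simp: d_def)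
    then show "y \<in> (+) u' ` M" by blast
  qed
qed (use K in blast)

end

theory Submission
  imports Defs
begin

text \<open>
  The theorem rests on one description of affine hulls. For submodular \<open>w\<close>, the inequality
  \<open>x\<^sub>A \<le> w(A)\<close> holds with equality on all of \<open>\<Pi>(w)\<close> exactly when \<open>w\<close> decomposes along
  \<open>I = A \<squnion> (I \<setminus> A)\<close>. If \<open>w\<close> decomposes, the inequalities of \<open>A\<close> and \<open>I \<setminus> A\<close> add up
  to the equation \<open>x\<^sub>I = w(I)\<close>, so neither has slack. For the converse,
  \<open>w(I \<setminus> A)\<close> must be finite: otherwise some direction \<open>e\<^sub>i - e\<^sub>j\<close> with \<open>i \<in> I \<setminus> A\<close>, \<open>j \<in> A\<close>
  could be added to points of \<open>\<Pi>(w)\<close> without leaving it, and \<open>x\<^sub>A\<close> would not be constant. Then \<open>A\<close> and its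
  complement are both always tight, and intersecting them with a set \<open>E\<close> that is tight at some
  point gives \<open>w(E) = w(E \<inter> A) + w(E \<setminus> A)\<close>. That every \<open>E\<close> with \<open>w(E) < \<infinity>\<close> is tight somewhere is
  \<open>exists_tight_point\<close>. As a polyhedron spans the affine space cut out by its implicit equations,
  \<open>aff \<Pi>(w)\<close> is cut out by the equations \<open>x\<^sub>A = w(A)\<close> for the sets \<open>A\<close> along which \<open>w\<close> decomposes
  (\<open>affine_hull_perm_polyhedron\<close>).

  This is applied to \<open>z\<close>, \<open>z\<^sup>P\<close> and \<open>z\<^sub>P\<close>.

  \<^item> \<open>z\<close> and \<open>z\<^sup>P\<close> decompose along \<open>A\<close> exactly when \<open>A\<close> and \<open>I \<setminus> A\<close> are disconnected in \<open>P\<close>: for \<open>z\<close>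
    this is compatibility and, conversely, conformity for the convex set \<open>I\<close>; for \<open>z\<^sup>P\<close> the converse
    holds because finiteness at \<open>I\<close> forces both sets to be down-sets. So \<open>\<Pi>(z)\<close> and
    \<open>\<Pi>(z\<^sup>P)\<close> have the same affine hull. Its direction space is the orthogonal complement in \<open>\<real>I\<close> of the indicator vectors of the components, which are
    orthogonal to each other, whence the dimension \<open>|I| - |c(P)|\<close>.

  \<^item> If \<open>z\<^sub>P\<close> decomposes along \<open>A\<close>, then \<open>A\<close> is a union of bubbles, since by conformity \<open>z\<^sub>b\<close> has no
    proper decomposition for a bubble \<open>b\<close>. So \<open>aff \<Pi>(z\<^sub>P)\<close> is given by prescribing \<open>x\<^sub>b\<close> for
    every bubble \<open>b\<close>, equivalently by \<open>x\<^sub>A = z(A)\<close> for all down-sets \<open>A\<close>.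

  Removing maximal bubbles one at a time shows \<open>z\<^sub>P \<le> z\<close> with equality on down-sets, so \<open>\<Pi>(z\<^sub>P)\<close> is
  the face of \<open>\<Pi>(z)\<close> where all down-sets are tight. Any point \<open>u\<close> of this face makes all inequalities
  of \<open>\<Pi>(z\<^sup>P)\<close> tight, so \<open>\<Pi>(z\<^sup>P) = u + K\<close> with \<open>K\<close> the cone of the homogeneous inequalities; its
  lineality subspace is \<open>{x. x\<^sub>A = z(A) for all down-sets A}\<close>, the affine space just found.
\<close>

section \<open>Coordinate sums\<close>

definition coord_sum :: "real ^ 'i \<Rightarrow> 'i::finite set \<Rightarrow> real" where
  "coord_sum x A = (\<Sum>i\<in>A. x $ i)"

lemma coord_sum_empty [simp]: "coord_sum x {} = 0"
  by (simp add: coord_sum_def)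

lemma coord_sum_zero [simp]: "coord_sum 0 A = 0"
  by (simp add: coord_sum_def)

lemma coord_sum_add [simp]: "coord_sum (x + y) A = coord_sum x A + coord_sum y A"
  by (simp add: coord_sum_def sum.distrib)

lemma coord_sum_minus [simp]: "coord_sum (- x) A = - coord_sum x A"
  by (simp add: coord_sum_def sum_negf)

lemma coord_sum_diff [simp]: "coord_sum (x - y) A = coord_sum x A - coord_sum y A"
  by (simp add: coord_sum_def sum_subtractf)

lemma coord_sum_scaleR [simp]: "coord_sum (c *\<^sub>R x) A = c * coord_sum x A"
  by (simp add: coord_sum_def sum_distrib_left)

lemma coord_sum_axis: "coord_sum (axis j c) A = (if j \<in> A then c else 0)"
  by (simp add: coord_sum_def axis_def sum.delta if_distrib cong: if_cong)

lemma coord_sum_singleton [simp]: "coord_sum x {i} = x $ i"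
  by (simp add: coord_sum_def)

lemma coord_sum_Un_disjoint:
  "A \<inter> B = {} \<Longrightarrow> coord_sum x (A \<union> B) = coord_sum x A + coord_sum x B"
  by (simp add: coord_sum_def sum.union_disjoint)

lemma coord_sum_Un_Int:
  "coord_sum x (A \<union> B) + coord_sum x (A \<inter> B) = coord_sum x A + coord_sum x B"
  by (simp add: coord_sum_def sum.union_inter)

lemma coord_sum_Diff: "A \<subseteq> B \<Longrightarrow> coord_sum x (B - A) = coord_sum x B - coord_sum x A"
  by (simp add: coord_sum_def sum_diff)

lemma coord_sum_supported:
  assumes "\<And>i. i \<notin> B \<Longrightarrow> x $ i = 0"
  shows "coord_sum x A = coord_sum x (A \<inter> B)"
  unfolding coord_sum_def by (rule sum.mono_neutral_right) (auto simp: assms)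

lemma partition_on_finite:
  "partition_on (I :: 'i::finite set) \<C> \<Longrightarrow> finite \<C>"
  by (simp add: finite_elements)

lemma coord_sum_partition:
  assumes "partition_on I \<C>" "A \<subseteq> I"
  shows "coord_sum x A = (\<Sum>C\<in>\<C>. coord_sum x (A \<inter> C))"
proof -
  have "A = \<Union>((\<lambda>C. A \<inter> C) ` \<C>)"
    using partition_onD1[OF assms(1)] assms(2) by blast
  then have "coord_sum x A = coord_sum x (\<Union>C\<in>\<C>. A \<inter> C)" by metis
  also have "\<dots> = (\<Sum>C\<in>\<C>. coord_sum x (A \<inter> C))"
    unfolding coord_sum_def
    by (rule sum.UNION_disjoint)
      (use assms partition_onD2[OF assms(1)] in
        \<open>auto simp: disjoint_def pairwise_def disjnt_def partition_on_finite\<close>)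
  finally show ?thesis .
qed

text \<open>
  The guard \<open>w A < \<infinity>\<close> in the definition of \<open>\<Pi>(w)\<close> can be dropped, because the inequality is
  vacuous for \<open>w A = \<infinity>\<close>; this spares a case distinction whenever inequalities are added.
\<close>
lemma mem_perm_polyhedron:
  "x \<in> perm_polyhedron I w \<longleftrightarrow>
     (\<forall>i. i \<notin> I \<longrightarrow> x $ i = 0) \<and> ereal (coord_sum x I) = w I \<and>
     (\<forall>A\<subseteq>I. ereal (coord_sum x A) \<le> w A)"
proof -
  have "(w A < \<infinity> \<longrightarrow> ereal c \<le> w A) \<longleftrightarrow> ereal c \<le> w A" for A c
    by (cases "w A") simp_all
  then show ?thesis
    unfolding perm_polyhedron_def coord_sum_def by simp
qed

section \<open>Submodular functions, minors and products\<close>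

lemma submodularD:
  assumes "submodular I z"
  shows "z {} = 0" "z I < \<infinity>" "\<And>A. A \<subseteq> I \<Longrightarrow> z A \<noteq> -\<infinity>"
    "\<And>A B. A \<subseteq> I \<Longrightarrow> B \<subseteq> I \<Longrightarrow> z (A \<union> B) + z (A \<inter> B) \<le> z A + z B"
  using assms unfolding submodular_def by blast+

lemma submodular_finite_Un_Int:
  assumes z: "submodular I z" and "A \<subseteq> I" "B \<subseteq> I" "z A < \<infinity>" "z B < \<infinity>"
  shows "z (A \<union> B) < \<infinity>" "z (A \<inter> B) < \<infinity>"
proof -
  have "A \<union> B \<subseteq> I" "A \<inter> B \<subseteq> I" using assms by auto
  then have "z (A \<union> B) \<noteq> -\<infinity>" "z (A \<inter> B) \<noteq> -\<infinity>" using submodularD(3)[OF z] by auto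
  then show "z (A \<union> B) < \<infinity>" "z (A \<inter> B) < \<infinity>"
    using submodularD(4)[OF z assms(2,3)] assms(4,5)
    by (cases "z (A \<union> B)"; cases "z (A \<inter> B)"; cases "z A"; cases "z B"; simp)+
qed

lemma submodular_subset:
  assumes "submodular I z" "B \<subseteq> I" "z B < \<infinity>"
  shows "submodular B z"
  using assms unfolding submodular_def by (meson order_trans)

lemma submodular_cong:
  assumes "submodular I z" "\<And>A. A \<subseteq> I \<Longrightarrow> w A = z A"
  shows "submodular I w"
  using assms unfolding submodular_def by (simp add: le_supI le_infI1)

text \<open>
  Submodularity of the minor is submodularity of \<open>z\<close> at \<open>A \<union> U\<close> and \<open>A \<union> V\<close>.
\<close>
lemma submodular_minor:
  assumes z: "submodular I z" and AB: "A \<subseteq> B" "B \<subseteq> I" and fin: "z A < \<infinity>" "z B < \<infinity>"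
  shows "submodular (B - A) (minor z A)"
proof -
  obtain a where a: "z A = ereal a"
    using submodularD(3)[OF z, of A] AB fin by (cases "z A") auto
  have sub: "A \<union> U \<subseteq> I" if "U \<subseteq> B - A" for U using that AB by blast
  have ninf: "z (A \<union> U) \<noteq> -\<infinity>" if "U \<subseteq> B - A" for U
    using submodularD(3)[OF z sub[OF that]] .
  show ?thesis
    unfolding submodular_def
  proof (intro conjI allI impI)
    fix U assume "U \<subseteq> B - A"
    then show "minor z A U \<noteq> -\<infinity>"
      using ninf[of U] a by (cases "z (A \<union> U)") (auto simp: minor_def)
  next
    show "minor z A {} = 0" by (simp add: minor_def a)
    have "A \<union> (B - A) = B" using AB by blast
    then show "minor z A (B - A) < \<infinity>"
      using fin a by (cases "z B") (auto simp: minor_def)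
  next
    fix U V assume UV: "U \<subseteq> B - A" "V \<subseteq> B - A"
    then have i: "U \<union> V \<subseteq> B - A" "U \<inter> V \<subseteq> B - A" by blast+
    have e: "(A \<union> U) \<union> (A \<union> V) = A \<union> (U \<union> V)" "(A \<union> U) \<inter> (A \<union> V) = A \<union> (U \<inter> V)"
      using UV by blast+
    have "z (A \<union> (U \<union> V)) + z (A \<union> (U \<inter> V)) \<le> z (A \<union> U) + z (A \<union> V)"
      using submodularD(4)[OF z sub[OF UV(1)] sub[OF UV(2)]] unfolding e .
    then show "minor z A (U \<union> V) + minor z A (U \<inter> V) \<le> minor z A U + minor z A V"
      unfolding minor_def a using ninf[OF UV(1)] ninf[OF UV(2)] ninf[OF i(1)] ninf[OF i(2)]
      by (cases "z (A \<union> U)"; cases "z (A \<union> V)"; cases "z (A \<union> (U \<union> V))";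
          cases "z (A \<union> (U \<inter> V))") auto
  qed
qed

lemma sum_ereal_neq_MInf:
  fixes f :: "'a \<Rightarrow> ereal"
  assumes "\<And>x. x \<in> S \<Longrightarrow> f x \<noteq> -\<infinity>"
  shows "sum f S \<noteq> -\<infinity>"
  using assms by (induction S rule: infinite_finite_induct) auto

lemma submodular_setfun_prod:
  fixes I :: "'i::finite set"
  assumes part: "partition_on I \<C>" and u: "\<And>C. C \<in> \<C> \<Longrightarrow> submodular C (u C)"
  shows "submodular I (setfun_prod \<C> u)"
  unfolding submodular_def setfun_prod_def
proof (intro conjI allI impI)
  fix A assume "A \<subseteq> I"
  show "(\<Sum>C\<in>\<C>. u C (A \<inter> C)) \<noteq> - \<infinity>"
    using submodularD(3)[OF u] by (intro sum_ereal_neq_MInf) simp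
next
  show "(\<Sum>C\<in>\<C>. u C ({} \<inter> C)) = 0"
    using submodularD(1)[OF u] by simp
  have "u C (I \<inter> C) < \<infinity>" if "C \<in> \<C>" for C
  proof -
    have "I \<inter> C = C" using partition_onD1[OF part] that by blast
    then show ?thesis using submodularD(2)[OF u[OF that]] by simp
  qed
  then show "(\<Sum>C\<in>\<C>. u C (I \<inter> C)) < \<infinity>"
    by (force simp: less_top[symmetric] sum_Pinfty top_ereal_def)
next
  fix A B assume "A \<subseteq> I" "B \<subseteq> I"
  have "(\<Sum>C\<in>\<C>. u C ((A \<union> B) \<inter> C)) + (\<Sum>C\<in>\<C>. u C ((A \<inter> B) \<inter> C))
      = (\<Sum>C\<in>\<C>. u C ((A \<inter> C) \<union> (B \<inter> C)) + u C ((A \<inter> C) \<inter> (B \<inter> C)))"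
    unfolding sum.distrib
    by (intro arg_cong2[of _ _ _ _ "(+)"] sum.cong refl arg_cong[of _ _ "u _"]) blast+
  also have "\<dots> \<le> (\<Sum>C\<in>\<C>. u C (A \<inter> C) + u C (B \<inter> C))"
    by (intro sum_mono submodularD(4)[OF u]) auto
  finally show "(\<Sum>C\<in>\<C>. u C ((A \<union> B) \<inter> C)) + (\<Sum>C\<in>\<C>. u C ((A \<inter> B) \<inter> C))
      \<le> (\<Sum>C\<in>\<C>. u C (A \<inter> C)) + (\<Sum>C\<in>\<C>. u C (B \<inter> C))"
    by (simp add: sum.distrib)
qed

section \<open>Existence of points with a prescribed tight set\<close>

text \<open>
  Restriction to \<open>B\<close> and contraction of \<open>B\<close> give independent problems: for \<open>A \<subseteq> I\<close> the two bounds
  add up to \<open>z(A \<inter> B) + z(A \<union> B) - z(B)\<close>, which is at most \<open>z(A)\<close>.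
\<close>
lemma perm_polyhedron_glue:
  assumes z: "submodular I z" and B: "B \<subseteq> I" "z B < \<infinity>"
    and x: "x \<in> perm_polyhedron B z" and y: "y \<in> perm_polyhedron (I - B) (minor z B)"
  shows "x + y \<in> perm_polyhedron I z" "ereal (coord_sum (x + y) B) = z B"
proof -
  obtain b where b: "z B = ereal b"
    using submodularD(3)[OF z, of B] B by (cases "z B") auto
  have sum: "coord_sum (x + y) A = coord_sum x (A \<inter> B) + coord_sum y (A - B)" if "A \<subseteq> I" for A
  proof -
    have "coord_sum x A = coord_sum x (A \<inter> B)"
      using x by (intro coord_sum_supported) (auto simp: mem_perm_polyhedron)
    moreover have "coord_sum y A = coord_sum y (A \<inter> (I - B))"
      using y by (intro coord_sum_supported) (auto simp: mem_perm_polyhedron)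
    moreover have "A \<inter> (I - B) = A - B" using that by blast
    ultimately show ?thesis by simp
  qed
  have xB: "coord_sum x B = b" using x b by (simp add: mem_perm_polyhedron)
  show "ereal (coord_sum (x + y) B) = z B"
    using sum[OF B(1)] xB b by simp
  have "B \<union> (I - B) = I" using B by blast
  then have "ereal (coord_sum y (I - B)) = z I - ereal b"
    using y b by (simp add: mem_perm_polyhedron minor_def)
  then have top: "ereal (coord_sum (x + y) I) = z I"
    using sum[of I] xB B submodularD(3)[OF z, of I] submodularD(2)[OF z]
    by (cases "z I") (auto simp: inf_absorb2)
  have le: "ereal (coord_sum (x + y) A) \<le> z A" if A: "A \<subseteq> I" for A
  proof (cases "z A = \<infinity>")
    case False
    then have fA: "z A < \<infinity>" by simp
    have s: "z (A \<union> B) + z (A \<inter> B) \<le> z A + z B" using submodularD(4)[OF z A B(1)] .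
    have f: "z (A \<union> B) \<noteq> \<infinity>" "z (A \<inter> B) \<noteq> \<infinity>"
      using submodular_finite_Un_Int[OF z A B(1) fA B(2)] by auto
    have n: "z (A \<union> B) \<noteq> -\<infinity>" "z (A \<inter> B) \<noteq> -\<infinity>" "z A \<noteq> -\<infinity>"
      using submodularD(3)[OF z] A B by (simp_all add: le_infI1)
    have "A - B \<subseteq> I - B" using A by blast
    then have "ereal (coord_sum y (A - B)) \<le> minor z B (A - B)"
      using y by (simp add: mem_perm_polyhedron)
    moreover have "B \<union> (A - B) = A \<union> B" by blast
    ultimately have "ereal (coord_sum y (A - B)) \<le> z (A \<union> B) - ereal b"
      by (simp add: minor_def b)
    moreover have "ereal (coord_sum x (A \<inter> B)) \<le> z (A \<inter> B)"
      using x by (simp add: mem_perm_polyhedron)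
    ultimately show ?thesis
      using s f n b unfolding sum[OF A]
      by (cases "z (A \<union> B)"; cases "z (A \<inter> B)"; cases "z A") auto
  qed simp
  show "x + y \<in> perm_polyhedron I z"
    unfolding mem_perm_polyhedron
  proof (intro conjI allI impI top le)
    fix i assume "i \<notin> I"
    then have "x $ i = 0" "y $ i = 0" using x y B by (auto simp: mem_perm_polyhedron)
    then show "(x + y) $ i = 0" by simp
  qed
qed

text \<open>
  As long as a proper nonempty set has a finite value, the ground set can be split there and the
  pieces glued. If none is left, \<open>x\<^sub>I = z(I)\<close> is the only condition, and one coordinate can
  carry the whole value.
\<close>
lemma perm_polyhedron_nonempty:
  fixes I :: "'i::finite set"
  assumes "submodular I z"
  shows "perm_polyhedron I z \<noteq> {}"
  using assms
proof (induction "card I" arbitrary: I z rule: less_induct)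
  case less
  note z = less.prems
  show ?case
  proof (cases "\<exists>B. B \<subset> I \<and> B \<noteq> {} \<and> z B < \<infinity>")
    case True
    then obtain B where B: "B \<subset> I" "B \<noteq> {}" "z B < \<infinity>" by blast
    have BI: "B \<subseteq> I" using B(1) by (rule psubset_imp_subset)
    have "card B < card I" using B(1) by (intro psubset_card_mono) simp_all
    from less.hyps[OF this submodular_subset[OF z BI B(3)]]
    obtain x where x: "x \<in> perm_polyhedron B z" by (metis ex_in_conv)
    have "I - B \<subset> I" using B by blast
    then have "card (I - B) < card I" by (intro psubset_card_mono) simp_all
    from less.hyps[OF this submodular_minor[OF z BI order_refl B(3) submodularD(2)[OF z]]]
    obtain y where y: "y \<in> perm_polyhedron (I - B) (minor z B)" by (metis ex_in_conv)
    show ?thesis using perm_polyhedron_glue(1)[OF z BI B(3) x y] by (metis empty_iff)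
  next
    case False
    then have inf: "z A = \<infinity>" if "A \<subseteq> I" "A \<noteq> {}" "A \<noteq> I" for A
      using that False by (metis ereal_infty_less(1) psubsetI)
    obtain r where r: "z I = ereal r"
      using submodularD(2,3)[OF z] by (cases "z I") auto
    show ?thesis
    proof (cases "I = {}")
      case True
      then have "0 \<in> perm_polyhedron I z"
        using submodularD(1)[OF z] by (simp add: mem_perm_polyhedron)
      then show ?thesis by blast
    next
      case False
      then obtain j where j: "j \<in> I" by blast
      have "ereal (coord_sum (axis j r) A) \<le> z A" if "A \<subseteq> I" for A
        using inf[OF that] submodularD(1)[OF z] r j
        by (cases "A = {}"; cases "A = I") (auto simp: coord_sum_axis)
      moreover have "axis j r $ i = 0" if "i \<notin> I" for i
        using j that by (auto simp: axis_def)
      ultimately have "axis j r \<in> perm_polyhedron I z"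
        using j r unfolding mem_perm_polyhedron by (simp add: coord_sum_axis)
      then show ?thesis by blast
    qed
  qed
qed

lemma exists_tight_point:
  assumes z: "submodular I z" and B: "B \<subseteq> I" "z B < \<infinity>"
  obtains x where "x \<in> perm_polyhedron I z" "ereal (coord_sum x B) = z B"
proof -
  obtain x where "x \<in> perm_polyhedron B z"
    using perm_polyhedron_nonempty[OF submodular_subset[OF z B]] by blast
  moreover obtain y where "y \<in> perm_polyhedron (I - B) (minor z B)"
    using perm_polyhedron_nonempty[OF submodular_minor[OF z B(1) order_refl B(2) submodularD(2)[OF z]]]
    by blast
  ultimately show ?thesis using perm_polyhedron_glue[OF z B] that by blast
qed

section \<open>Affine hulls and decompositions\<close>

lemma submodular_finite_Inter:
  fixes I :: "'i::finite set"
  assumes z: "submodular I z" and "\<S> \<noteq> {}" "\<And>A. A \<in> \<S> \<Longrightarrow> A \<subseteq> I \<and> z A < \<infinity>"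
  shows "\<Inter>\<S> \<subseteq> I \<and> z (\<Inter>\<S>) < \<infinity>"
proof -
  have "finite \<S>" by simp
  then show ?thesis using assms(2,3)
  proof (induction \<S> rule: finite_ne_induct)
    case (insert A \<S>)
    then have "\<Inter>\<S> \<subseteq> I \<and> z (\<Inter>\<S>) < \<infinity>" "A \<subseteq> I" "z A < \<infinity>" by simp_all
    then show ?case using submodular_finite_Un_Int(2)[OF z, of A "\<Inter>\<S>"] by auto
  qed simp
qed

lemma submodular_finite_UNION:
  fixes I :: "'i::finite set"
  assumes z: "submodular I z" and "\<And>i. i \<in> S \<Longrightarrow> f i \<subseteq> I \<and> z (f i) < \<infinity>"
  shows "(\<Union>i\<in>S. f i) \<subseteq> I \<and> z (\<Union>i\<in>(S::'i set). f i) < \<infinity>"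
proof -
  have "finite S" by simp
  then show ?thesis using assms(2)
  proof (induction S rule: finite_induct)
    case empty
    then show ?case using submodularD(1)[OF z] by simp
  next
    case (insert i S)
    then have "(\<Union>i\<in>S. f i) \<subseteq> I \<and> z (\<Union>i\<in>S. f i) < \<infinity>" "f i \<subseteq> I" "z (f i) < \<infinity>" by simp_all
    then show ?case using submodular_finite_Un_Int(1)[OF z, of "f i" "\<Union>i\<in>S. f i"] by auto
  qed
qed

text \<open>
  The sets with finite value form a lattice. If every \<open>i \<in> B\<close> had its smallest finite set inside
  \<open>B\<close>, then \<open>B\<close> would be the union of these sets and have a finite value itself.
\<close>
lemma infinite_value_separation:
  fixes I :: "'i::finite set"
  assumes z: "submodular I z" and B: "B \<subseteq> I" "z B = \<infinity>"
  obtains i j where "i \<in> B" "j \<in> I - B" "\<And>A. A \<subseteq> I \<Longrightarrow> z A < \<infinity> \<Longrightarrow> i \<in> A \<Longrightarrow> j \<in> A"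
proof -
  \<comment> \<open>the smallest set with finite value that contains \<open>i\<close>\<close>
  define m where "m i = \<Inter>{A. A \<subseteq> I \<and> z A < \<infinity> \<and> i \<in> A}" for i
  have I: "I \<in> {A. A \<subseteq> I \<and> z A < \<infinity> \<and> i \<in> A}" if "i \<in> B" for i
    using that B submodularD(2)[OF z] by blast
  have m: "m i \<subseteq> I \<and> z (m i) < \<infinity>" if "i \<in> B" for i
    unfolding m_def using I[OF that] by (intro submodular_finite_Inter[OF z]) blast+
  have "i \<in> m i" for i by (simp add: m_def)
  have "\<exists>i\<in>B. \<not> m i \<subseteq> B"
  proof (rule ccontr)
    assume "\<not> ?thesis"
    then have "(\<Union>i\<in>B. m i) = B" using \<open>\<And>i. i \<in> m i\<close> by blast
    then show False using submodular_finite_UNION[OF z, of B m] m B(2) by simp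
  qed
  then obtain i j where ij: "i \<in> B" "j \<in> m i" "j \<notin> B" by blast
  then have "j \<in> I - B" using m by blast
  with ij that show ?thesis by (auto simp: m_def)
qed

text \<open>
  Mass can be moved from \<open>j\<close> to \<open>i\<close> if every set whose coordinate sum would grow has the value
  \<open>\<infinity>\<close>.
\<close>
lemma perm_polyhedron_recession:
  assumes x: "x \<in> perm_polyhedron I z" and ij: "i \<in> I" "j \<in> I"
    and sep: "\<And>A. A \<subseteq> I \<Longrightarrow> z A < \<infinity> \<Longrightarrow> i \<in> A \<Longrightarrow> j \<in> A"
  shows "x + (axis i 1 - axis j 1) \<in> perm_polyhedron I z"
proof -
  have "ereal (coord_sum (x + (axis i 1 - axis j 1)) A) \<le> z A" if "A \<subseteq> I" for A
  proof (cases "z A < \<infinity>")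
    case True
    then have "coord_sum (x + (axis i 1 - axis j 1)) A \<le> coord_sum x A"
      using sep[OF that] by (simp add: coord_sum_axis)
    moreover have "ereal (coord_sum x A) \<le> z A" using x that by (simp add: mem_perm_polyhedron)
    ultimately show ?thesis by (meson ereal_less_eq(3) order_trans)
  qed simp
  then show ?thesis
    using x ij unfolding mem_perm_polyhedron by (auto simp: coord_sum_axis) (auto simp: axis_def)
qed

lemma decomposes_imp_tight:
  assumes z: "submodular I z" and A: "A \<subseteq> I" and dec: "decomposes z I A (I - A)"
    and x: "x \<in> perm_polyhedron I z"
  shows "ereal (coord_sum x A) = z A"
proof -
  have "I \<inter> A = A" "I \<inter> (I - A) = I - A" using A by blast+
  then have "z I = z A + z (I - A)" using dec unfolding decomposes_def by (metis order_refl)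
  moreover have "ereal (coord_sum x I) = z I" "ereal (coord_sum x A) \<le> z A"
    "ereal (coord_sum x (I - A)) \<le> z (I - A)"
    using x A by (simp_all add: mem_perm_polyhedron)
  ultimately show ?thesis
    using coord_sum_Diff[OF A, of x] submodularD(3)[OF z A] submodularD(2,3)[OF z]
    by (cases "z A"; cases "z (I - A)"; cases "z I") auto
qed

text \<open>
  The bounds at \<open>A \<union> B\<close> and \<open>A \<inter> B\<close> add up to at most \<open>z(A) + z(B) = x\<^sub>A + x\<^sub>B\<close>, which is also the
  sum of \<open>x\<close> over both sets. So neither bound has slack.
\<close>
lemma tight_Int:
  assumes z: "submodular I z" and x: "x \<in> perm_polyhedron I z" and AB: "A \<subseteq> I" "B \<subseteq> I"
    and t: "ereal (coord_sum x A) = z A" "ereal (coord_sum x B) = z B"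
  shows "ereal (coord_sum x (A \<inter> B)) = z (A \<inter> B)"
proof -
  have "A \<union> B \<subseteq> I" "A \<inter> B \<subseteq> I" using AB by auto
  then have "ereal (coord_sum x (A \<union> B)) \<le> z (A \<union> B)" "ereal (coord_sum x (A \<inter> B)) \<le> z (A \<inter> B)"
    using x by (simp_all add: mem_perm_polyhedron)
  moreover have "z (A \<union> B) + z (A \<inter> B) \<le> ereal (coord_sum x A) + ereal (coord_sum x B)"
    using submodularD(4)[OF z AB] t by simp
  ultimately show ?thesis
    using coord_sum_Un_Int[of x A B]
    by (cases "z (A \<union> B)"; cases "z (A \<inter> B)") auto
qed

text \<open>
  Only sets that are tight at a common point can be intersected, so the complement of \<open>A\<close> must be
  shown to be always tight as well. The hypothesis gives no finiteness of \<open>z(I \<setminus> A)\<close>; this comes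
  from the recession direction that an infinite value would produce.
\<close>
lemma always_tight_imp_decomposes:
  fixes I :: "'i::finite set"
  assumes z: "submodular I z" and A: "A \<subseteq> I"
    and tight: "\<And>x. x \<in> perm_polyhedron I z \<Longrightarrow> ereal (coord_sum x A) = z A"
  shows "decomposes z I A (I - A)"
proof -
  have CI: "I - A \<subseteq> I" by blast
  have fin: "z (I - A) < \<infinity>"
  proof (rule ccontr)
    assume "\<not> z (I - A) < \<infinity>"
    then have inf: "z (I - A) = \<infinity>" by simp
    obtain i j where i: "i \<in> I - A" and j: "j \<in> I - (I - A)"
      and sep: "\<And>E. E \<subseteq> I \<Longrightarrow> z E < \<infinity> \<Longrightarrow> i \<in> E \<Longrightarrow> j \<in> E"
      using infinite_value_separation[OF z CI inf] by blast
    obtain x where x: "x \<in> perm_polyhedron I z"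
      using perm_polyhedron_nonempty[OF z] by blast
    have "x + (axis i 1 - axis j 1) \<in> perm_polyhedron I z"
      using perm_polyhedron_recession[OF x _ _ sep] i j by blast
    then have "ereal (coord_sum (x + (axis i 1 - axis j 1)) A) = ereal (coord_sum x A)"
      using tight x by metis
    then show False using i j by (simp add: coord_sum_axis)
  qed
  \<comment> \<open>\<open>x\<^sub>A\<close> and \<open>x\<^sub>I\<close> are constant on \<open>\<Pi>(z)\<close>, so a single point that is tight at \<open>I \<setminus> A\<close> suffices.\<close>
  have "ereal (coord_sum x (I - A)) = z (I - A)" if x: "x \<in> perm_polyhedron I z" for x
  proof -
    obtain y where y: "y \<in> perm_polyhedron I z" and ty: "ereal (coord_sum y (I - A)) = z (I - A)"
      using exists_tight_point[OF z CI fin] by blast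
    have "ereal (coord_sum x A) = ereal (coord_sum y A)"
      "ereal (coord_sum x I) = ereal (coord_sum y I)"
      using tight[OF x] tight[OF y] x y by (simp_all add: mem_perm_polyhedron)
    then show ?thesis using ty coord_sum_Diff[OF A] by simp
  qed
  note tight' = this
  have "z E = z (E \<inter> A) + z (E \<inter> (I - A))" if E: "E \<subseteq> I" for E
  proof (cases "z E < \<infinity>")
    case True
    then obtain x where x: "x \<in> perm_polyhedron I z" and t: "ereal (coord_sum x E) = z E"
      using exists_tight_point[OF z E] by blast
    have "E \<inter> A \<inter> (E \<inter> (I - A)) = {}" "E \<inter> A \<union> E \<inter> (I - A) = E" using E by blast+
    then have "coord_sum x E = coord_sum x (E \<inter> A) + coord_sum x (E \<inter> (I - A))"
      using coord_sum_Un_disjoint by metis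
    then show ?thesis
      using tight_Int[OF z x E A t tight[OF x]] tight_Int[OF z x E CI t tight'[OF x]] t
      by (metis plus_ereal.simps(1))
  next
    case False
    have "(E \<inter> A) \<inter> (E \<inter> (I - A)) = {}" "(E \<inter> A) \<union> (E \<inter> (I - A)) = E" using E by blast+
    then have "z E + 0 \<le> z (E \<inter> A) + z (E \<inter> (I - A))"
      using submodularD(4)[OF z, of "E \<inter> A" "E \<inter> (I - A)"] A submodularD(1)[OF z]
      by (metis CI le_infI2)
    then show ?thesis using False by simp
  qed
  then show ?thesis using A unfolding decomposes_def by blast
qed

lemma convex_perm_polyhedron: "convex (perm_polyhedron I w)"
proof (rule convexI)
  fix x y and u v :: real
  assume x: "x \<in> perm_polyhedron I w" and y: "y \<in> perm_polyhedron I w"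
    and uv: "0 \<le> u" "0 \<le> v" "u + v = 1"
  obtain r where r: "w I = ereal r" "coord_sum x I = r" "coord_sum y I = r"
    using x y by (metis ereal.inject mem_perm_polyhedron)
  have "ereal (coord_sum (u *\<^sub>R x + v *\<^sub>R y) A) \<le> w A" if "A \<subseteq> I" for A
  proof (cases "w A")
    case (real a)
    then have "coord_sum x A \<le> a" "coord_sum y A \<le> a"
      using x y that by (metis ereal_less_eq(3) mem_perm_polyhedron)+
    then show ?thesis using convex_bound_le[of _ a _ u v] uv real by simp
  next
    case MInf
    then show ?thesis using x that by (metis ereal_infty_less_eq(2) MInfty_neq_ereal(2) mem_perm_polyhedron)
  qed simp
  moreover have "u * r + v * r = r" using uv by (metis distrib_right mult_1)
  ultimately show "u *\<^sub>R x + v *\<^sub>R y \<in> perm_polyhedron I w"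
    using x y r by (simp add: mem_perm_polyhedron)
qed

lemma affine_coord_sum_eq:
  "affine {x. (\<forall>i. i \<notin> I \<longrightarrow> x $ i = 0) \<and> (\<forall>A. Q A \<longrightarrow> ereal (coord_sum x A) = w A)}"
  unfolding affine_def
proof (intro ballI allI impI, clarify)
  fix x y and u v :: real
  assume *: "\<forall>i. i \<notin> I \<longrightarrow> x $ i = 0" "\<forall>A. Q A \<longrightarrow> ereal (coord_sum x A) = w A"
    "\<forall>i. i \<notin> I \<longrightarrow> y $ i = 0" "\<forall>A. Q A \<longrightarrow> ereal (coord_sum y A) = w A" "u + v = 1"
  have "coord_sum (u *\<^sub>R x + v *\<^sub>R y) A = coord_sum x A" if "Q A" for A
  proof -
    have "coord_sum y A = coord_sum x A" using * that by (metis ereal.inject)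
    then show ?thesis using *(5) by (simp flip: distrib_right)
  qed
  then show "(\<forall>i. i \<notin> I \<longrightarrow> (u *\<^sub>R x + v *\<^sub>R y) $ i = 0) \<and>
      (\<forall>A. Q A \<longrightarrow> ereal (coord_sum (u *\<^sub>R x + v *\<^sub>R y) A) = w A)"
    using * by simp
qed

text \<open>
  A point \<open>p\<close> of the relative interior satisfies every inequality strictly that is not always
  tight. From \<open>p\<close> one can therefore move a little towards any solution \<open>y\<close> of the implicit
  equations, so that \<open>y\<close> is on a line through two points of \<open>\<Pi>(z)\<close>.
\<close>
lemma affine_hull_perm_polyhedron:
  fixes I :: "'i::finite set"
  assumes z: "submodular I z"
  shows "affine hull (perm_polyhedron I z) =
    {x. (\<forall>i. i \<notin> I \<longrightarrow> x $ i = 0) \<and>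
        (\<forall>A. A \<subseteq> I \<and> decomposes z I A (I - A) \<longrightarrow> ereal (coord_sum x A) = z A)}" (is "_ = ?L")
proof (rule antisym)
  have "perm_polyhedron I z \<subseteq> ?L"
    using decomposes_imp_tight[OF z] by (auto simp: mem_perm_polyhedron)
  then show "affine hull (perm_polyhedron I z) \<subseteq> ?L"
    by (intro hull_minimal affine_coord_sum_eq)
next
  let ?S = "perm_polyhedron I z"
  show "?L \<subseteq> affine hull ?S"
  proof
    fix y assume y: "y \<in> ?L"
    obtain p where pr: "p \<in> rel_interior ?S"
      using perm_polyhedron_nonempty[OF z] rel_interior_eq_empty convex_perm_polyhedron by blast
    then have p: "p \<in> ?S" using rel_interior_subset by blast
    have slack: "ereal (coord_sum p A) < z A" if A: "A \<subseteq> I" "\<not> decomposes z I A (I - A)" for A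
    proof -
      obtain q where q: "q \<in> ?S" "ereal (coord_sum q A) \<noteq> z A"
        using always_tight_imp_decomposes[OF z] A by blast
      then have qA: "ereal (coord_sum q A) < z A"
        using A by (auto simp: mem_perm_polyhedron less_le)
      \<comment> \<open>The segment from \<open>q\<close> to \<open>p\<close> extends beyond \<open>p\<close>; as \<open>q\<close> is not tight at \<open>A\<close>, neither is \<open>p\<close>.\<close>
      obtain e where e: "e > 1" "(1 - e) *\<^sub>R q + e *\<^sub>R p \<in> ?S"
        using pr q convex_rel_interior_iff[OF convex_perm_polyhedron perm_polyhedron_nonempty[OF z]]
        by blast
      then have le: "ereal (coord_sum ((1 - e) *\<^sub>R q + e *\<^sub>R p) A) \<le> z A"
        using A by (simp add: mem_perm_polyhedron)
      show ?thesis
      proof (cases "z A")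
        case (real a)
        then have "(1 - e) * coord_sum q A + e * coord_sum p A \<le> a" "coord_sum q A < a"
          using le qA by simp_all
        moreover from this have "(e - 1) * coord_sum q A < (e - 1) * a" using e by simp
        ultimately have "e * coord_sum p A < e * a" by (simp add: algebra_simps)
        then show ?thesis using e real by simp
      qed (use qA in auto)
    qed
    define c where "c t = p + t *\<^sub>R (y - p)" for t :: real
    have "\<forall>\<^sub>F t in at_right 0. \<forall>A\<in>Pow I. ereal (coord_sum (c t) A) \<le> z A"
    proof (rule eventually_ball_finite)
      show "\<forall>A\<in>Pow I. \<forall>\<^sub>F t in at_right 0. ereal (coord_sum (c t) A) \<le> z A"
      proof
        fix A assume "A \<in> Pow I"
        then have A: "A \<subseteq> I" by blast
        show "\<forall>\<^sub>F t in at_right 0. ereal (coord_sum (c t) A) \<le> z A"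
        proof (cases "decomposes z I A (I - A)")
          case True
          then have "ereal (coord_sum p A) = z A" "ereal (coord_sum y A) = z A"
            using decomposes_imp_tight[OF z A True p] y A by auto
          then have "coord_sum y A = coord_sum p A" by (metis ereal.inject)
          then show ?thesis using \<open>ereal (coord_sum p A) = z A\<close> by (simp add: c_def)
        next
          case False
          have "((\<lambda>t. coord_sum p A + t * (coord_sum y A - coord_sum p A)) \<longlongrightarrow>
              coord_sum p A + 0 * (coord_sum y A - coord_sum p A)) (at_right 0)"
            by (intro tendsto_intros)
          then have "((\<lambda>t. ereal (coord_sum (c t) A)) \<longlongrightarrow> ereal (coord_sum p A)) (at_right 0)"
            by (simp add: c_def)
          from order_tendstoD(2)[OF this slack[OF A False]]
          show ?thesis by eventually_elim simp
        qed
      qed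
    qed simp
    then have "\<forall>\<^sub>F t in at_right 0. t > 0 \<and> (\<forall>A\<in>Pow I. ereal (coord_sum (c t) A) \<le> z A)"
      using eventually_at_right_less[of "0::real"] by eventually_elim blast
    from eventually_happens'[OF trivial_limit_at_right_real this]
    obtain t where t: "t > 0" "\<forall>A\<in>Pow I. ereal (coord_sum (c t) A) \<le> z A" by blast
    \<comment> \<open>The equation \<open>x\<^sub>I = z(I)\<close> comes from the trivial decomposition.\<close>
    have "decomposes z I I (I - I)"
      using submodularD(1)[OF z] by (auto simp: decomposes_def inf_absorb1)
    then have "ereal (coord_sum y I) = ereal (coord_sum p I)"
      using y p by (auto simp: mem_perm_polyhedron)
    then have "ereal (coord_sum (c t) I) = z I"
      using p by (simp add: c_def mem_perm_polyhedron)
    then have ct: "c t \<in> ?S"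
      using t y p by (auto simp: mem_perm_polyhedron c_def)
    have "y = (1 - 1 / t) *\<^sub>R p + (1 / t) *\<^sub>R c t"
      using t by (simp add: c_def algebra_simps)
    also have "\<dots> \<in> affine hull ?S"
      by (rule mem_affine) (auto simp: hull_inc p ct)
    finally show "y \<in> affine hull ?S" .
  qed
qed

section \<open>Preorders, bubbles and down-sets\<close>

lemma preorder_onD:
  assumes "preorder_on I P"
  shows "P \<subseteq> I \<times> I" "\<And>x. x \<in> I \<Longrightarrow> (x, x) \<in> P"
    "\<And>x y w. (x, y) \<in> P \<Longrightarrow> (y, w) \<in> P \<Longrightarrow> (x, w) \<in> P"
  using assms unfolding preorder_on_def refl_on_def trans_def by blast+

lemma partition_on_bubbles:
  assumes "preorder_on I P"
  shows "partition_on I (bubbles I P)"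
  unfolding bubbles_def
proof (rule partition_on_quotient, rule equivI)
  show "P \<inter> P\<inverse> \<subseteq> I \<times> I" "refl_on I (P \<inter> P\<inverse>)" "sym (P \<inter> P\<inverse>)"
    using preorder_onD[OF assms] by (auto simp: refl_on_def sym_def)
  show "trans (P \<inter> P\<inverse>)"
    using preorder_onD(3)[OF assms] by (auto simp: trans_def)
qed

lemma partition_on_components_of:
  assumes "preorder_on I P"
  shows "partition_on I (components_of I P)"
  unfolding components_of_def
proof (rule partition_on_quotient, rule equivI)
  have sub: "P \<union> P\<inverse> \<subseteq> I \<times> I" using preorder_onD(1)[OF assms] by blast
  show "(P \<union> P\<inverse>)\<^sup>+ \<subseteq> I \<times> I" using trancl_subset_Sigma[OF sub] .
  show "refl_on I ((P \<union> P\<inverse>)\<^sup>+)"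
    using preorder_onD(2)[OF assms] by (auto simp: refl_on_def)
  show "sym ((P \<union> P\<inverse>)\<^sup>+)" by (intro sym_trancl sym_Un_converse)
qed simp

lemma bubble_comparable:
  assumes "preorder_on I P" "b \<in> bubbles I P" "x \<in> b" "y \<in> b"
  shows "(x, y) \<in> P"
  using assms(2-4) preorder_onD(3)[OF assms(1)]
  unfolding bubbles_def quotient_def by blast

lemma bubble_nonempty:
  assumes "preorder_on I P" "b \<in> bubbles I P"
  shows "b \<noteq> {}" "b \<subseteq> I"
  using partition_onD1[OF partition_on_bubbles[OF assms(1)]]
    partition_onD3[OF partition_on_bubbles[OF assms(1)]] assms(2) by auto

lemma bubble_closed:
  assumes "preorder_on I P" "b \<in> bubbles I P" "x \<in> b" "(x, y) \<in> P" "(y, x) \<in> P"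
  shows "y \<in> b"
  using assms(2-5) preorder_onD(3)[OF assms(1)]
  unfolding bubbles_def quotient_def by blast

lemma down_set_bubble_dichotomy:
  assumes "preorder_on I P" "b \<in> bubbles I P" "down_set I P A"
  shows "b \<subseteq> A \<or> b \<inter> A = {}"
  using bubble_comparable[OF assms(1,2)] assms(3) unfolding down_set_def by blast

lemma down_set_Un: "down_set I P A \<Longrightarrow> down_set I P B \<Longrightarrow> down_set I P (A \<union> B)"
  and down_set_Int: "down_set I P A \<Longrightarrow> down_set I P B \<Longrightarrow> down_set I P (A \<inter> B)"
  unfolding down_set_def by blast+

lemma down_set_trivial:
  assumes "preorder_on I P"
  shows "down_set I P {}" "down_set I P I"
  using preorder_onD(1)[OF assms] unfolding down_set_def by blast+

text \<open>
  The witnesses are the down-set generated by \<open>b\<close> and the part of it strictly below \<open>b\<close>.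
\<close>
lemma bubble_convex:
  assumes pre: "preorder_on I P" and b: "b \<in> bubbles I P"
  obtains A B where "down_set I P A" "down_set I P B" "A \<subseteq> B" "b = B - A"
proof -
  define B where "B = {x. \<exists>y\<in>b. (x, y) \<in> P}"
  have bB: "b \<subseteq> B" unfolding B_def
    using preorder_onD(2)[OF pre] bubble_nonempty[OF pre b] by blast
  have "down_set I P B"
    using preorder_onD(1,3)[OF pre] unfolding down_set_def B_def by blast
  moreover have "down_set I P (B - b)"
    unfolding down_set_def
  proof (intro conjI allI impI)
    fix x y assume xy: "(x, y) \<in> P" "y \<in> B - b"
    then obtain w where w: "w \<in> b" "(y, w) \<in> P" unfolding B_def by blast
    have "x \<notin> b"
    proof
      assume "x \<in> b"
      then have "(w, x) \<in> P" using bubble_comparable[OF pre b] w by blast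
      then have "(w, y) \<in> P" using xy preorder_onD(3)[OF pre] by blast
      then show False using bubble_closed[OF pre b w(1)] w xy by blast
    qed
    then show "x \<in> B - b" using xy w preorder_onD(3)[OF pre] unfolding B_def by blast
  qed (use \<open>down_set I P B\<close> in \<open>auto simp: down_set_def\<close>)
  moreover have "b = B - (B - b)" using bB by blast
  ultimately show ?thesis using that by blast
qed

text \<open>
  This makes down-sets accessible to induction on cardinality.
\<close>
lemma down_set_maximal_bubble:
  fixes I :: "'i::finite set"
  assumes pre: "preorder_on I P" and A: "down_set I P A" "A \<noteq> {}"
  obtains b where "b \<in> bubbles I P" "b \<subseteq> A" "down_set I P (A - b)"
proof -
  \<comment> \<open>An element with the largest number of elements below it lies in a maximal bubble.\<close>
  define f where "f m = card {x. (x, m) \<in> P}" for m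
  have "Max (f ` A) \<in> f ` A" using A(2) by (intro Max_in) simp_all
  then obtain m where "m \<in> A" "f m = Max (f ` A)" by (metis imageE)
  then have m: "m \<in> A" "\<And>y. y \<in> A \<Longrightarrow> f y \<le> f m" by simp_all
  have max: "(y, m) \<in> P" if y: "y \<in> A" "(m, y) \<in> P" for y
  proof -
    have "{x. (x, m) \<in> P} \<subseteq> {x. (x, y) \<in> P}" using y preorder_onD(3)[OF pre] by blast
    then have "{x. (x, m) \<in> P} = {x. (x, y) \<in> P}"
      using m(2)[OF y(1)] unfolding f_def by (intro card_seteq) simp_all
    then show ?thesis using y A(1) preorder_onD(2)[OF pre] unfolding down_set_def by blast
  qed
  have "m \<in> I" using m A unfolding down_set_def by blast
  then obtain b where b: "b \<in> bubbles I P" "m \<in> b"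
    using partition_onD1[OF partition_on_bubbles[OF pre]] by blast
  have "b \<subseteq> A" using down_set_bubble_dichotomy[OF pre b(1) A(1)] b m by blast
  moreover have "down_set I P (A - b)"
    unfolding down_set_def
  proof (intro conjI allI impI)
    fix x y assume xy: "(x, y) \<in> P" "y \<in> A - b"
    have "x \<notin> b"
    proof
      assume "x \<in> b"
      then have "(m, y) \<in> P" using bubble_comparable[OF pre b(1,2)] xy preorder_onD(3)[OF pre] by blast
      then have "y \<in> b" using bubble_closed[OF pre b] max xy by blast
      then show False using xy by blast
    qed
    then show "x \<in> A - b" using xy A unfolding down_set_def by blast
  qed (use A in \<open>auto simp: down_set_def\<close>)
  ultimately show ?thesis using that b by blast
qed

section \<open>The function \<open>z\<^sub>P\<close>\<close>

lemma compatible_down_set_finite: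
  "compatible I z P \<Longrightarrow> down_set I P A \<Longrightarrow> z A < \<infinity>"
  unfolding compatible_def by blast

lemma submodular_zconv:
  assumes z: "submodular I z" and pre: "preorder_on I P" and c: "compatible I z P"
    and b: "b \<in> bubbles I P"
  shows "submodular b (zconv I z P b)"
proof -
  obtain A B where AB: "down_set I P A" "down_set I P B" "A \<subseteq> B" "b = B - A"
    using bubble_convex[OF pre b] .
  then have "B \<subseteq> I" unfolding down_set_def by blast
  then have "submodular b (minor z A)"
    using submodular_minor[OF z AB(3)] AB compatible_down_set_finite[OF c] by blast
  then show ?thesis
    by (rule submodular_cong) (use zconv_eq[OF z c AB(1-3)] AB(4) in blast)
qed

lemma submodular_z_lower:
  fixes I :: "'i::finite set"
  assumes "submodular I z" "preorder_on I P" "compatible I z P"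
  shows "submodular I (z_lower I z P)"
  unfolding z_lower_def
  by (intro submodular_setfun_prod partition_on_bubbles submodular_zconv assms)

lemma z_lower_remove_bubble:
  fixes I :: "'i::finite set"
  assumes z: "submodular I z" and pre: "preorder_on I P" and c: "compatible I z P"
    and b: "b \<in> bubbles I P"
  shows "z_lower I z P E = z_lower I z P (E - b) + zconv I z P b (E \<inter> b)"
proof -
  let ?u = "zconv I z P"
  have fin: "finite (bubbles I P)" using partition_on_finite[OF partition_on_bubbles[OF pre]] .
  have "(E - b) \<inter> C = E \<inter> C" if "C \<in> bubbles I P - {b}" for C
    using partition_onD2[OF partition_on_bubbles[OF pre]] that b unfolding disjoint_def by blast
  then have "(\<Sum>C\<in>bubbles I P - {b}. ?u C ((E - b) \<inter> C)) = (\<Sum>C\<in>bubbles I P - {b}. ?u C (E \<inter> C))"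
    by (intro sum.cong) auto
  moreover have "(E - b) \<inter> b = {}" by blast
  then have "?u b ((E - b) \<inter> b) = 0"
    using submodularD(1)[OF submodular_zconv[OF z pre c b]] by (simp only:)
  ultimately show ?thesis
    unfolding z_lower_def setfun_prod_def sum.remove[OF fin b] by (simp add: add.commute)
qed

text \<open>
  Along a chain of down-sets that grows by one bubble at a time, \<open>z\<^sub>P(E)\<close> is the sum of the
  increments \<open>z(D \<union> E') - z(D)\<close> with \<open>E'\<close> the part of \<open>E\<close> in the next bubble. By submodularity each
  is at most the increment of \<open>z\<close> along \<open>E\<close> itself, and for \<open>E\<close> a down-set in the chain the sum
  telescopes. Both statements use the same induction, so they are proved together.
\<close>
lemma z_lower_le_and_eq_on_down_set:
  fixes I :: "'i::finite set"
  assumes z: "submodular I z" and pre: "preorder_on I P" and c: "compatible I z P"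
    and A: "down_set I P A"
  shows "(\<forall>E\<subseteq>A. z_lower I z P E \<le> z E) \<and> z_lower I z P A = z A"
  using A
proof (induction "card A" arbitrary: A rule: less_induct)
  case less
  let ?l = "z_lower I z P"
  show ?case
  proof (cases "A = {}")
    case True
    then show ?thesis
      using submodularD(1)[OF z] submodularD(1)[OF submodular_z_lower[OF z pre c]] by simp
  next
    case False
    then obtain b where b: "b \<in> bubbles I P" "b \<subseteq> A" "down_set I P (A - b)"
      using down_set_maximal_bubble[OF pre less.prems] by blast
    define D where "D = A - b"
    have D: "down_set I P D" "D \<subseteq> A" "D \<subseteq> I" "A \<subseteq> I" "b = A - D"
      using b less.prems by (auto simp: D_def down_set_def)
    obtain d where d: "z D = ereal d"
      using compatible_down_set_finite[OF c D(1)] submodularD(3)[OF z D(3)] by (cases "z D") auto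
    have "card D < card A"
      using b bubble_nonempty[OF pre b(1)] by (intro psubset_card_mono) (auto simp: D_def)
    note IH = less.hyps[OF this D(1)]
    have split: "?l E = ?l (E \<inter> D) + (z (D \<union> E) - ereal d)" if E: "E \<subseteq> A" for E
    proof -
      have "zconv I z P b (E \<inter> b) = minor z D (E \<inter> b)"
        unfolding D(5) by (rule zconv_eq[OF z c D(1) less.prems D(2)]) blast
      moreover have "D \<union> (E \<inter> b) = D \<union> E" "E - b = E \<inter> D" using E by (auto simp: D_def)
      ultimately show ?thesis
        using z_lower_remove_bubble[OF z pre c b(1), of E] by (simp add: minor_def d)
    qed
    have "?l E \<le> z E" if E: "E \<subseteq> A" for E
    proof -
      have ED: "E \<subseteq> I" "D \<union> E \<subseteq> I" "E \<inter> D \<subseteq> I" using E D by blast+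
      have "?l (E \<inter> D) \<le> z (E \<inter> D)" using IH by simp
      then have "?l E \<le> z (E \<inter> D) + (z (D \<union> E) - ereal d)"
        unfolding split[OF E] by (rule add_right_mono)
      moreover have "z (E \<union> D) + z (E \<inter> D) \<le> z E + ereal d"
        using submodularD(4)[OF z ED(1) D(3)] by (simp add: d)
      ultimately show ?thesis
        using submodularD(3)[OF z ED(1)] submodularD(3)[OF z ED(2)] submodularD(3)[OF z ED(3)]
        by (cases "z E"; cases "z (D \<union> E)"; cases "z (E \<inter> D)"; cases "?l E")
          (auto simp: Un_commute)
    qed
    moreover have "?l A = z A"
    proof -
      have "A \<inter> D = D" "D \<union> A = A" using D by blast+
      then show ?thesis
        using split[of A] IH d submodularD(3)[OF z D(4)] by (cases "z A") auto
    qed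
    ultimately show ?thesis by blast
  qed
qed

lemma z_lower_decomposes_at_down_set:
  fixes I :: "'i::finite set"
  assumes z: "submodular I z" and pre: "preorder_on I P" and c: "compatible I z P"
    and A: "down_set I P A"
  shows "decomposes (z_lower I z P) I A (I - A)"
proof -
  have "zconv I z P b (E \<inter> b) =
      zconv I z P b (E \<inter> A \<inter> b) + zconv I z P b (E \<inter> (I - A) \<inter> b)"
    if b: "b \<in> bubbles I P" for b E
  proof -
    have 0: "zconv I z P b {} = 0" using submodularD(1)[OF submodular_zconv[OF z pre c b]] .
    have bI: "b \<subseteq> I" using bubble_nonempty[OF pre b] by blast
    show ?thesis
    proof (cases "b \<subseteq> A")
      case True
      then have "E \<inter> A \<inter> b = E \<inter> b" "E \<inter> (I - A) \<inter> b = {}" by blast+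
      then show ?thesis using 0 by simp
    next
      case False
      then have "b \<inter> A = {}" using down_set_bubble_dichotomy[OF pre b A] by blast
      then have "E \<inter> A \<inter> b = {}" "E \<inter> (I - A) \<inter> b = E \<inter> b" using bI by blast+
      then show ?thesis using 0 by simp
    qed
  qed
  then have "z_lower I z P E = z_lower I z P (E \<inter> A) + z_lower I z P (E \<inter> (I - A))" for E
    unfolding z_lower_def setfun_prod_def sum.distrib[symmetric] by (intro sum.cong refl) blast
  moreover have "A \<subseteq> I" using A unfolding down_set_def by blast
  ultimately show ?thesis unfolding decomposes_def by blast
qed

text \<open>
  A bubble that meets both \<open>A\<close> and its complement would give a proper decomposition of \<open>z\<^sub>b\<close>.
  Conformity turns that into a disconnected union, but the elements of a bubble are comparable.
\<close>
lemma z_lower_decomposes_imp_bubble_dichotomy: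
  fixes I :: "'i::finite set"
  assumes z: "submodular I z" and pre: "preorder_on I P" and conf: "conforms I z P"
    and dec: "decomposes (z_lower I z P) I A (I - A)" and b: "b \<in> bubbles I P"
  shows "b \<subseteq> A \<or> b \<inter> A = {}"
proof -
  have c: "compatible I z P" using conf unfolding conforms_def by blast
  have bI: "b \<subseteq> I" using bubble_nonempty[OF pre b] by blast
  have on_b: "z_lower I z P E = zconv I z P b E" if "E \<subseteq> b" for E
  proof -
    have "E - b = {}" "E \<inter> b = E" using that by blast+
    then have "z_lower I z P E = z_lower I z P {} + zconv I z P b E"
      using z_lower_remove_bubble[OF z pre c b, of E] by (simp only:)
    then show ?thesis using submodularD(1)[OF submodular_z_lower[OF z pre c]] by simp
  qed
  have "zconv I z P b E = zconv I z P b (E \<inter> (b \<inter> A)) + zconv I z P b (E \<inter> (b - A))"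
    if E: "E \<subseteq> b" for E
  proof -
    have "E \<inter> (b \<inter> A) = E \<inter> A" "E \<inter> (b - A) = E \<inter> (I - A)" using E bI by blast+
    moreover have "E \<inter> A \<subseteq> b" "E \<inter> (I - A) \<subseteq> b" "E \<subseteq> I" using E bI by blast+
    ultimately show ?thesis using dec on_b E unfolding decomposes_def by metis
  qed
  moreover have "b = (b \<inter> A) \<union> (b - A)" "(b \<inter> A) \<inter> (b - A) = {}" by blast+
  ultimately have "decomposes (zconv I z P b) b (b \<inter> A) (b - A)"
    unfolding decomposes_def by blast
  moreover have "convex_subset I P b"
    using bubble_convex[OF pre b] unfolding convex_subset_def by metis
  ultimately have "disconnected_union P b (b \<inter> A) (b - A)"
    using conf unfolding conforms_def by blast
  then show ?thesis
    using bubble_comparable[OF pre b] unfolding disconnected_union_def by blast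
qed

text \<open>
  On \<open>\<Pi>(z\<^sub>P)\<close> down-sets are tight because \<open>z\<^sub>P\<close> decomposes along each of them. Conversely,
  tightness of the down-sets \<open>A \<subseteq> B\<close> with \<open>b = B \<setminus> A\<close> turns the inequality of \<open>z\<close> at \<open>A \<union> U\<close>
  into that of \<open>z\<^sub>b\<close> at \<open>U\<close>, and these add up over the bubbles.
\<close>
lemma perm_polyhedron_z_lower_eq:
  fixes I :: "'i::finite set"
  assumes z: "submodular I z" and pre: "preorder_on I P" and c: "compatible I z P"
  shows "perm_polyhedron I (z_lower I z P) =
    {x \<in> perm_polyhedron I z. \<forall>A. down_set I P A \<longrightarrow> ereal (coord_sum x A) = z A}"
    (is "?L = ?R")
proof (intro set_eqI iffI)
  fix x assume x: "x \<in> ?L"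
  note le = z_lower_le_and_eq_on_down_set[OF z pre c]
  note I = down_set_trivial(2)[OF pre]
  have "ereal (coord_sum x A) = z A" if A: "down_set I P A" for A
    using decomposes_imp_tight[OF submodular_z_lower[OF z pre c] _
        z_lower_decomposes_at_down_set[OF z pre c A] x] le[OF A] A
    by (simp add: down_set_def)
  moreover have "ereal (coord_sum x A) \<le> z A" if "A \<subseteq> I" for A
    using x le[OF I] that order_trans by (metis mem_perm_polyhedron)
  ultimately show "x \<in> ?R"
    using x I unfolding mem_perm_polyhedron mem_Collect_eq by blast
next
  fix x assume x: "x \<in> ?R"
  then have tight: "ereal (coord_sum x A) = z A" if "down_set I P A" for A
    using that by blast
  have bub: "ereal (coord_sum x U) \<le> zconv I z P b U" if b: "b \<in> bubbles I P" and U: "U \<subseteq> b" for b U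
  proof -
    obtain A B where AB: "down_set I P A" "down_set I P B" "A \<subseteq> B" "b = B - A"
      using bubble_convex[OF pre b] .
    have sub: "A \<union> U \<subseteq> I" and disj: "A \<inter> U = {}"
      using AB U unfolding down_set_def by blast+
    from sub have "ereal (coord_sum x (A \<union> U)) \<le> z (A \<union> U)"
      using x unfolding mem_perm_polyhedron mem_Collect_eq by blast
    moreover note coord_sum_Un_disjoint[OF disj, of x]
    moreover have "zconv I z P b U = z (A \<union> U) - ereal (coord_sum x A)"
      using zconv_eq[OF z c AB(1-3)] U tight[OF AB(1)] by (simp add: minor_def AB(4))
    ultimately show ?thesis by (cases "z (A \<union> U)") auto
  qed
  have "ereal (coord_sum x E) \<le> z_lower I z P E" if E: "E \<subseteq> I" for E
  proof -
    have "ereal (coord_sum x E) = (\<Sum>b\<in>bubbles I P. ereal (coord_sum x (E \<inter> b)))"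
      using coord_sum_partition[OF partition_on_bubbles[OF pre] E] by simp
    also have "\<dots> \<le> z_lower I z P E"
      unfolding z_lower_def setfun_prod_def by (intro sum_mono bub) auto
    finally show ?thesis .
  qed
  then show "x \<in> ?L"
    using x z_lower_le_and_eq_on_down_set[OF z pre c down_set_trivial(2)[OF pre]]
    unfolding mem_perm_polyhedron mem_Collect_eq by simp
qed

text \<open>
  Tight sets are those where a linear functional attains its upper bound \<open>z(A)\<close>, and a proper convex
  combination attains an upper bound only if both of its points do.
\<close>
lemma face_of_tight_sets:
  "{x \<in> perm_polyhedron I z. \<forall>A. A \<subseteq> I \<and> Q A \<longrightarrow> ereal (coord_sum x A) = z A} face_of perm_polyhedron I z"
  (is "?F face_of ?S")
proof -
  let ?L = "{x. (\<forall>i. i \<notin> I \<longrightarrow> x $ i = 0) \<and>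
      (\<forall>A. A \<subseteq> I \<and> Q A \<longrightarrow> ereal (coord_sum x A) = z A)}"
  have "convex (?S \<inter> ?L)"
    by (intro convex_Int convex_perm_polyhedron affine_imp_convex affine_coord_sum_eq)
  moreover have "?F = ?S \<inter> ?L" by (auto simp: mem_perm_polyhedron)
  ultimately have "convex ?F" by (simp only:)
  moreover have "a \<in> ?F \<and> b \<in> ?F"
    if a: "a \<in> ?S" and b: "b \<in> ?S" and x: "x \<in> ?F" "x \<in> open_segment a b" for a b x
  proof -
    obtain u where u: "0 < u" "u < 1" "x = (1 - u) *\<^sub>R a + u *\<^sub>R b"
      using x(2) by (auto simp: in_segment)
    have "ereal (coord_sum a A) = z A \<and> ereal (coord_sum b A) = z A" if A: "A \<subseteq> I" "Q A" for A
    proof -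
      have xA: "z A = ereal (coord_sum x A)" using x(1) A by auto
      then have le: "coord_sum a A \<le> coord_sum x A" "coord_sum b A \<le> coord_sum x A"
        using a b A by (auto simp: mem_perm_polyhedron)
      have e: "(1 - u) * (coord_sum x A - coord_sum a A) + u * (coord_sum x A - coord_sum b A) = 0"
        unfolding u(3) by (simp add: algebra_simps)
      have "0 \<le> (1 - u) * (coord_sum x A - coord_sum a A)" "0 \<le> u * (coord_sum x A - coord_sum b A)"
        using u le by simp_all
      then have "(1 - u) * (coord_sum x A - coord_sum a A) = 0" "u * (coord_sum x A - coord_sum b A) = 0"
        using e by linarith+
      then show ?thesis using u xA by simp
    qed
    then show ?thesis using a b by blast
  qed
  ultimately show ?thesis unfolding face_of_def by blast
qed

text \<open>
  The nontrivial inclusion is that tightness on down-sets implies tightness wherever \<open>z\<^sub>P\<close>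
  decomposes: such sets are unions of bubbles, and on a bubble \<open>b = B \<setminus> A\<close> the coordinate sum
  is the difference of the values of \<open>z\<close> at \<open>B\<close> and \<open>A\<close>.
\<close>
lemma affine_hull_z_lower:
  fixes I :: "'i::finite set"
  assumes z: "submodular I z" and pre: "preorder_on I P" and conf: "conforms I z P"
  shows "affine hull (perm_polyhedron I (z_lower I z P)) =
    {x. (\<forall>i. i \<notin> I \<longrightarrow> x $ i = 0) \<and> (\<forall>A. down_set I P A \<longrightarrow> ereal (coord_sum x A) = z A)}"
    (is "_ = ?L")
proof
  have c: "compatible I z P" using conf unfolding conforms_def by blast
  let ?l = "z_lower I z P"
  note l = submodular_z_lower[OF z pre c]
  show "affine hull (perm_polyhedron I ?l) \<subseteq> ?L"
    by (intro hull_minimal affine_coord_sum_eq)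
      (auto simp: perm_polyhedron_z_lower_eq[OF z pre c] mem_perm_polyhedron)
  show "?L \<subseteq> affine hull (perm_polyhedron I ?l)"
  proof
    fix x assume x: "x \<in> ?L"
    then have tight: "ereal (coord_sum x A) = z A" if "down_set I P A" for A
      using that by blast
    have bub: "ereal (coord_sum x b) = zconv I z P b b" if b: "b \<in> bubbles I P" for b
    proof -
      obtain A B where AB: "down_set I P A" "down_set I P B" "A \<subseteq> B" "b = B - A"
        using bubble_convex[OF pre b] .
      have "A \<union> b = B" using AB by blast
      then have "zconv I z P b b = ereal (coord_sum x B) - ereal (coord_sum x A)"
        using zconv_eq[OF z c AB(1-3), of b] tight[OF AB(1)] tight[OF AB(2)] AB(4)
        by (simp add: minor_def)
      then show ?thesis using coord_sum_Diff[OF AB(3), of x] AB(4) by simp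
    qed
    have "ereal (coord_sum x A) = ?l A" if A: "A \<subseteq> I" "decomposes ?l I A (I - A)" for A
    proof -
      have "ereal (coord_sum x (A \<inter> b)) = zconv I z P b (A \<inter> b)" if b: "b \<in> bubbles I P" for b
      proof -
        consider "A \<inter> b = b" | "A \<inter> b = {}"
          using z_lower_decomposes_imp_bubble_dichotomy[OF z pre conf A(2) b] by blast
        then show ?thesis
          using bub[OF b] submodularD(1)[OF submodular_zconv[OF z pre c b]] by cases simp_all
      qed
      then have "(\<Sum>b\<in>bubbles I P. ereal (coord_sum x (A \<inter> b))) = ?l A"
        unfolding z_lower_def setfun_prod_def by (intro sum.cong refl)
      then show ?thesis
        using coord_sum_partition[OF partition_on_bubbles[OF pre] A(1)] by simp
    qed
    then show "x \<in> affine hull (perm_polyhedron I ?l)"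
      using x unfolding affine_hull_perm_polyhedron[OF l] by blast
  qed
qed

section \<open>The dimension formula\<close>

definition indicator_vec :: "'i::finite set \<Rightarrow> real ^ 'i" where
  "indicator_vec A = (\<chi> i. if i \<in> A then 1 else 0)"

lemma inner_indicator_vec: "indicator_vec A \<bullet> x = coord_sum x A"
proof -
  have "indicator_vec A \<bullet> x = (\<Sum>i\<in>UNIV. if i \<in> A then x $ i else 0)"
    unfolding indicator_vec_def inner_vec_def by (intro sum.cong) simp_all
  then show ?thesis by (simp add: coord_sum_def sum.If_cases)
qed

lemma coord_sum_indicator_vec: "coord_sum (indicator_vec A) B = real (card (B \<inter> A))"
  by (simp add: indicator_vec_def coord_sum_def sum.If_cases)

text \<open>
  The equations are orthogonality to the indicator vectors of the sets. As the sets are disjoint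
  and nonempty, these vectors are orthogonal to each other and nonzero, hence independent.
\<close>
lemma dim_coord_sum_zero:
  fixes \<Q> :: "'i::finite set set"
  assumes disj: "disjoint \<Q>" and ne: "{} \<notin> \<Q>"
  shows "dim {y :: real ^ 'i. \<forall>C\<in>\<Q>. coord_sum y C = 0} + card \<Q> = CARD('i)"
proof -
  let ?V = "indicator_vec ` \<Q>"
  have pos: "indicator_vec C \<bullet> indicator_vec C \<noteq> 0" if "C \<in> \<Q>" for C
    using that ne by (auto simp: inner_indicator_vec coord_sum_indicator_vec simp del: inner_eq_zero_iff)
  have orth: "indicator_vec C \<bullet> indicator_vec D = 0" if "C \<in> \<Q>" "D \<in> \<Q>" "C \<noteq> D" for C D
    using disjointD[OF disj that] by (simp add: inner_indicator_vec coord_sum_indicator_vec)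
  have "inj_on indicator_vec \<Q>"
    using orth pos by (intro inj_onI) metis
  then have card: "card ?V = card \<Q>" by (rule card_image)
  have "pairwise orthogonal ?V" using orth by (auto simp: pairwise_def orthogonal_def)
  moreover have "0 \<notin> ?V" using pos by force
  ultimately have "independent ?V" by (rule pairwise_orthogonal_independent)
  then have "dim (span ?V) = card \<Q>" using dim_eq_card_independent card by (metis dim_span)
  moreover have "dim {y \<in> UNIV. \<forall>x \<in> span ?V. orthogonal x y} + dim (span ?V)
      = dim (UNIV :: (real ^ 'i) set)"
    by (intro dim_subspace_orthogonal_to_vectors) auto
  moreover have "{y \<in> UNIV. \<forall>x \<in> span ?V. orthogonal x y} = {y. \<forall>C\<in>\<Q>. coord_sum y C = 0}"
  proof -
    have "(\<forall>x \<in> span ?V. orthogonal x y) \<longleftrightarrow> (\<forall>x \<in> ?V. orthogonal x y)" for y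
      using orthogonal_to_span[of _ ?V y] span_base[of _ ?V] by (metis orthogonal_commute)
    then show ?thesis by (simp add: orthogonal_def inner_indicator_vec)
  qed
  ultimately show ?thesis by simp
qed

lemma disconnected_complement_iff:
  assumes "preorder_on I P" "A \<subseteq> I"
  shows "disconnected_union P I A (I - A) \<longleftrightarrow> down_set I P A \<and> down_set I P (I - A)"
  using assms(2) preorder_onD(1)[OF assms(1)]
  unfolding disconnected_union_def down_set_def by blast

lemma disconnected_complement_iff_components:
  assumes pre: "preorder_on I P" and A: "A \<subseteq> I"
  shows "disconnected_union P I A (I - A) \<longleftrightarrow> (\<forall>C\<in>components_of I P. C \<subseteq> A \<or> A \<inter> C = {})"
    (is "_ \<longleftrightarrow> ?R")
proof
  assume d: "disconnected_union P I A (I - A)"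
  have step: "y \<in> A" if "(x, y) \<in> P \<union> P\<inverse>" "x \<in> A" for x y
    using that d preorder_onD(1)[OF pre] unfolding disconnected_union_def by blast
  have closed: "y \<in> A" if "(x, y) \<in> (P \<union> P\<inverse>)\<^sup>+" "x \<in> A" for x y
    using that by (induction rule: trancl_induct) (use step in blast)+
  have "sym ((P \<union> P\<inverse>)\<^sup>+)" by (intro sym_trancl sym_Un_converse)
  then show ?R
    using closed unfolding components_of_def quotient_def by (blast dest: symD)
next
  assume R: ?R
  have "(x, y) \<notin> P \<and> (y, x) \<notin> P" if xy: "x \<in> A" "y \<in> I - A" for x y
  proof (rule ccontr)
    assume "\<not> ?thesis"
    then have "(x, y) \<in> (P \<union> P\<inverse>)\<^sup>+" by blast
    moreover have "(x, x) \<in> (P \<union> P\<inverse>)\<^sup>+" using preorder_onD(2)[OF pre, of x] xy A by blast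
    moreover have "(P \<union> P\<inverse>)\<^sup>+ `` {x} \<in> components_of I P"
      using xy A unfolding components_of_def by (blast intro: quotientI)
    ultimately show False using R xy by blast
  qed
  then show "disconnected_union P I A (I - A)"
    using A unfolding disconnected_union_def by blast
qed

text \<open>
  Components are disconnected from their complements, and every set with this property is a union
  of components, so only the equations of the components matter. The vanishing of the
  coordinates outside \<open>I\<close> is included by adding the singletons there to the components.
\<close>
lemma dim_zero_on_disconnected:
  fixes I :: "'i::finite set"
  assumes pre: "preorder_on I P"
  shows "int (dim {y :: real ^ 'i. (\<forall>i. i \<notin> I \<longrightarrow> y $ i = 0) \<and>
      (\<forall>A. A \<subseteq> I \<and> disconnected_union P I A (I - A) \<longrightarrow> coord_sum y A = 0)})
    = int (card I) - int (card (components_of I P))" (is "int (dim ?W) = _")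
proof -
  let ?C = "components_of I P" and ?O = "(\<lambda>i. {i}) ` (- I)"
  note part = partition_on_components_of[OF pre]
  have comp: "C \<subseteq> I \<and> C \<noteq> {}" if "C \<in> ?C" for C
    using partition_onD1[OF part] partition_onD3[OF part] that by blast
  have disj: "C \<inter> D = {}" if "C \<in> ?C" "D \<in> ?C" "C \<noteq> D" for C D
    using disjointD[OF partition_onD2[OF part]] that by blast
  have W: "?W = {y. \<forall>C\<in>?C \<union> ?O. coord_sum y C = 0}"
  proof (intro set_eqI iffI)
    fix y :: "real ^ 'i" assume y: "y \<in> ?W"
    have "coord_sum y C = 0" if C: "C \<in> ?C" for C
    proof -
      have sub: "C \<subseteq> I" using comp[OF C] by blast
      have "\<forall>D\<in>?C. D \<subseteq> C \<or> C \<inter> D = {}" using disj[OF C] by blast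
      then have "disconnected_union P I C (I - C)"
        unfolding disconnected_complement_iff_components[OF pre sub] .
      then show ?thesis using y sub by simp
    qed
    moreover have "coord_sum y C = 0" if "C \<in> ?O" for C
    proof -
      obtain i where "i \<notin> I" "C = {i}" using \<open>C \<in> ?O\<close> by blast
      then show ?thesis using y by simp
    qed
    ultimately show "y \<in> {y. \<forall>C\<in>?C \<union> ?O. coord_sum y C = 0}" by blast
  next
    fix y :: "real ^ 'i" assume y: "y \<in> {y. \<forall>C\<in>?C \<union> ?O. coord_sum y C = 0}"
    have "coord_sum y A = 0" if A: "A \<subseteq> I" "disconnected_union P I A (I - A)" for A
    proof -
      have "coord_sum y (A \<inter> C) = 0" if "C \<in> ?C" for C
      proof -
        consider "A \<inter> C = C" | "A \<inter> C = {}"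
          using A(2) \<open>C \<in> ?C\<close> unfolding disconnected_complement_iff_components[OF pre A(1)]
          by blast
        then show ?thesis using y \<open>C \<in> ?C\<close> by cases simp_all
      qed
      then show ?thesis using coord_sum_partition[OF part A(1), of y] by simp
    qed
    moreover have "y $ i = 0" if "i \<notin> I" for i
    proof -
      have "{i} \<in> ?C \<union> ?O" using that by blast
      then have "coord_sum y {i} = 0" using y by blast
      then show ?thesis by simp
    qed
    ultimately show "y \<in> ?W" by blast
  qed
  have "dim {y :: real ^ 'i. \<forall>C\<in>?C \<union> ?O. coord_sum y C = 0} + card (?C \<union> ?O) = CARD('i)"
  proof (rule dim_coord_sum_zero)
    show "disjoint (?C \<union> ?O)"
      unfolding disjoint_def using disj comp by blast
    show "{} \<notin> ?C \<union> ?O" using comp by blast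
  qed
  moreover have "card (?C \<union> ?O) = card ?C + card (- I)"
  proof -
    have "?C \<inter> ?O = {}" using comp by blast
    moreover have "card ?O = card (- I)" by (intro card_image) (simp add: inj_on_def)
    ultimately show ?thesis by (simp add: card_Un_disjoint partition_on_finite[OF part])
  qed
  moreover have "card (- I) + card I = CARD('i)"
    by (metis Compl_disjoint2 Compl_partition2 card_Un_disjoint finite)
  ultimately show ?thesis unfolding W by linarith
qed

section \<open>Decompositions of \<open>z\<close> and \<open>z\<^sup>P\<close>\<close>

lemma minor_empty:
  assumes "submodular I z"
  shows "minor z {} U = z U"
  using submodularD(1)[OF assms] by (simp add: minor_def)

lemma compatible_decomposes:
  assumes z: "submodular I z" and pre: "preorder_on I P" and c: "compatible I z P"
    and d: "disconnected_union P I A (I - A)"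
  shows "decomposes z I A (I - A)"
proof -
  have "disconnected_union P (I - {}) A (I - A)" using d by simp
  then have "decomposes (minor z {}) (I - {}) A (I - A)"
    using c down_set_trivial[OF pre] unfolding compatible_def by blast
  moreover have "minor z {} = z" using minor_empty[OF z] by blast
  ultimately show ?thesis by simp
qed

lemma conforms_decomposes_iff:
  assumes z: "submodular I z" and pre: "preorder_on I P" and conf: "conforms I z P" and A: "A \<subseteq> I"
  shows "decomposes z I A (I - A) \<longleftrightarrow> disconnected_union P I A (I - A)"
proof
  note ds = down_set_trivial[OF pre]
  have c: "compatible I z P" using conf unfolding conforms_def by blast
  assume dec: "decomposes z I A (I - A)"
  have eq: "zconv I z P I U = z U" if "U \<subseteq> I" for U
    using zconv_eq[OF z c ds empty_subsetI, of U] that minor_empty[OF z] by simp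
  have "zconv I z P I E = zconv I z P I (E \<inter> A) + zconv I z P I (E \<inter> (I - A))" if E: "E \<subseteq> I" for E
  proof -
    have "E \<inter> A \<subseteq> I" "E \<inter> (I - A) \<subseteq> I" using E by blast+
    then show ?thesis using dec E eq unfolding decomposes_def by metis
  qed
  then have "decomposes (zconv I z P I) I A (I - A)"
    using dec unfolding decomposes_def by blast
  moreover have "convex_subset I P I"
    unfolding convex_subset_def using ds by blast
  ultimately show "disconnected_union P I A (I - A)"
    using conf unfolding conforms_def by blast
next
  assume "disconnected_union P I A (I - A)"
  then show "decomposes z I A (I - A)"
    using compatible_decomposes[OF z pre] conf unfolding conforms_def by blast
qed

lemma submodular_z_upper:
  assumes z: "submodular I z" and pre: "preorder_on I P"
  shows "submodular I (z_upper I z P)"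
proof -
  let ?w = "z_upper I z P"
  have ninf: "?w A \<noteq> -\<infinity>" if "A \<subseteq> I" for A
    using submodularD(3)[OF z that] by (simp add: z_upper_def)
  have "?w (A \<union> B) + ?w (A \<inter> B) \<le> ?w A + ?w B" if AB: "A \<subseteq> I" "B \<subseteq> I" for A B
  proof (cases "down_set I P A \<and> down_set I P B")
    case True
    then show ?thesis
      using submodularD(4)[OF z AB] down_set_Un[of I P A B] down_set_Int[of I P A B]
      by (simp add: z_upper_def)
  next
    case False
    then have "?w A = \<infinity> \<or> ?w B = \<infinity>" by (auto simp: z_upper_def)
    then have "?w A + ?w B = \<infinity>" using ninf[OF AB(1)] ninf[OF AB(2)] by auto
    then show ?thesis by (simp only: ereal_less_eq(1))
  qed
  moreover have "?w {} = 0" "?w I < \<infinity>"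
    using submodularD(1,2)[OF z] down_set_trivial[OF pre] by (simp_all add: z_upper_def)
  ultimately show ?thesis using ninf unfolding submodular_def by blast
qed

text \<open>
  If \<open>z\<^sup>P\<close> decomposes along \<open>A\<close>, finiteness at \<open>I\<close> makes \<open>A\<close> and \<open>I \<setminus> A\<close> down-sets. For the
  converse, a set that is not a down-set has a trace on \<open>A\<close> or on \<open>I \<setminus> A\<close> that is not one, so
  both sides are \<open>\<infinity>\<close>.
\<close>
lemma z_upper_decomposes_iff:
  assumes z: "submodular I z" and pre: "preorder_on I P" and c: "compatible I z P" and A: "A \<subseteq> I"
  shows "decomposes (z_upper I z P) I A (I - A) \<longleftrightarrow> disconnected_union P I A (I - A)"
proof
  note ds = down_set_trivial[OF pre]
  assume "decomposes (z_upper I z P) I A (I - A)"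
  then have "z_upper I z P I = z_upper I z P (I \<inter> A) + z_upper I z P (I \<inter> (I - A))"
    unfolding decomposes_def by blast
  moreover have "I \<inter> A = A" "I \<inter> (I - A) = I - A" using A by blast+
  ultimately have sum: "z I = z_upper I z P A + z_upper I z P (I - A)"
    using ds by (simp add: z_upper_def)
  have "z_upper I z P A \<noteq> \<infinity> \<and> z_upper I z P (I - A) \<noteq> \<infinity>"
    using sum submodularD(2)[OF z] by auto
  then show "disconnected_union P I A (I - A)"
    unfolding disconnected_complement_iff[OF pre A] z_upper_def by (auto split: if_splits)
next
  assume d: "disconnected_union P I A (I - A)"
  then have dA: "down_set I P A" "down_set I P (I - A)"
    using disconnected_complement_iff[OF pre A] by blast+
  have dec: "decomposes z I A (I - A)" using compatible_decomposes[OF z pre c d] .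
  have "z_upper I z P E = z_upper I z P (E \<inter> A) + z_upper I z P (E \<inter> (I - A))" if E: "E \<subseteq> I" for E
  proof (cases "down_set I P E")
    case True
    then have "down_set I P (E \<inter> A)" "down_set I P (E \<inter> (I - A))" using dA down_set_Int by blast+
    then show ?thesis using True dec E unfolding z_upper_def decomposes_def by simp
  next
    case False
    have "E \<inter> A \<union> E \<inter> (I - A) = E" using E by blast
    then have "\<not> down_set I P (E \<inter> A) \<or> \<not> down_set I P (E \<inter> (I - A))"
      using False down_set_Un by metis
    moreover have "z_upper I z P U \<noteq> -\<infinity>" if "U \<subseteq> I" for U
      using submodularD(3)[OF submodular_z_upper[OF z pre] that] .
    ultimately show ?thesis using False unfolding z_upper_def by auto
  qed
  then show "decomposes (z_upper I z P) I A (I - A)"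
    using A unfolding decomposes_def by blast
qed

lemma affine_hull_z_upper:
  fixes I :: "'i::finite set"
  assumes z: "submodular I z" and pre: "preorder_on I P" and c: "compatible I z P"
  shows "affine hull (perm_polyhedron I (z_upper I z P)) =
    {x. (\<forall>i. i \<notin> I \<longrightarrow> x $ i = 0) \<and>
        (\<forall>A. A \<subseteq> I \<and> disconnected_union P I A (I - A) \<longrightarrow> ereal (coord_sum x A) = z A)}"
proof -
  have "A \<subseteq> I \<and> decomposes (z_upper I z P) I A (I - A) \<longleftrightarrow>
      A \<subseteq> I \<and> disconnected_union P I A (I - A)" for A
    using z_upper_decomposes_iff[OF z pre c] by blast
  moreover have "z_upper I z P A = z A" if "A \<subseteq> I \<and> disconnected_union P I A (I - A)" for A
    using that disconnected_complement_iff[OF pre, of A] by (simp add: z_upper_def)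
  ultimately show ?thesis
    unfolding affine_hull_perm_polyhedron[OF submodular_z_upper[OF z pre]] by auto
qed

section \<open>\<open>\<Pi>(z\<^sup>P)\<close> as a translated cone\<close>

lemma translation_eqI:
  fixes u :: "'a::ab_group_add"
  assumes "\<And>x. x \<in> S \<longleftrightarrow> x - u \<in> T"
  shows "S = (+) u ` T"
proof (intro set_eqI iffI)
  fix x assume "x \<in> S"
  then show "x \<in> (+) u ` T" using assms by (intro image_eqI[of _ _ "x - u"]) simp_all
next
  fix x assume "x \<in> (+) u ` T"
  then obtain t where "t \<in> T" "x = u + t" by blast
  then show "x \<in> S" using assms[of x] by simp
qed

lemma polyhedron_coord_sum_bounds:
  fixes a :: ereal
  shows "polyhedron {x :: real ^ 'i::finite. ereal (coord_sum x A) \<le> a}"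
    and "polyhedron {x :: real ^ 'i. ereal (coord_sum x A) = a}"
proof -
  have le: "polyhedron {x :: real ^ 'i. coord_sum x A \<le> r}"
    and eq: "polyhedron {x :: real ^ 'i. coord_sum x A = r}" for r
    using polyhedron_halfspace_le[of "indicator_vec A" r] polyhedron_hyperplane[of "indicator_vec A" r]
    unfolding inner_indicator_vec by blast+
  show "polyhedron {x :: real ^ 'i. ereal (coord_sum x A) \<le> a}"
    by (cases a) (use le in simp_all)
  show "polyhedron {x :: real ^ 'i. ereal (coord_sum x A) = a}"
    by (cases a) (use eq in simp_all)
qed

lemma polyhedron_perm_polyhedron: "polyhedron (perm_polyhedron I w)"
proof -
  let ?Z = "\<Inter>i\<in>- I. {x. ereal (coord_sum x {i}) = 0}"
    and ?T = "{x. ereal (coord_sum x I) = w I}"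
    and ?B = "\<Inter>A\<in>Pow I. {x. ereal (coord_sum x A) \<le> w A}"
  have "x \<in> ?Z \<longleftrightarrow> (\<forall>i. i \<notin> I \<longrightarrow> x $ i = 0)" for x
    by (auto simp: zero_ereal_def)
  moreover have "x \<in> ?B \<longleftrightarrow> (\<forall>A\<subseteq>I. ereal (coord_sum x A) \<le> w A)" for x by blast
  ultimately have "perm_polyhedron I w = ?Z \<inter> ?T \<inter> ?B"
    by (intro set_eqI) (simp only: Int_iff mem_Collect_eq mem_perm_polyhedron conj_assoc)
  moreover have "polyhedron ?Z" "polyhedron ?B"
    by (rule polyhedron_Inter, simp, erule imageE, simp only: polyhedron_coord_sum_bounds)+
  ultimately show ?thesis by (simp only: polyhedron_Int polyhedron_coord_sum_bounds(2))
qed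


text \<open>
  The function \<open>0\<^sup>P\<close> homogenizes the inequalities of \<open>\<Pi>(z\<^sup>P)\<close>. If \<open>P\<close> is compatible with the
  submodular function \<open>z\<close>, this is therefore the recession cone of \<open>\<Pi>(z\<^sup>P)\<close>.
\<close>
definition down_set_cone :: "'i::finite set \<Rightarrow> 'i rel \<Rightarrow> (real ^ 'i) set" where
  "down_set_cone I P = perm_polyhedron I (z_upper I (\<lambda>_. 0) P)"

lemma mem_down_set_cone:
  assumes pre: "preorder_on I P"
  shows "y \<in> down_set_cone I P \<longleftrightarrow> (\<forall>i. i \<notin> I \<longrightarrow> y $ i = 0) \<and> coord_sum y I = 0 \<and>
    (\<forall>A. down_set I P A \<longrightarrow> coord_sum y A \<le> 0)"
  using down_set_trivial(2)[OF pre]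
  unfolding down_set_cone_def mem_perm_polyhedron z_upper_def
  by (auto simp: down_set_def)

lemma polyhedral_cone_down_set_cone:
  assumes pre: "preorder_on I P"
  shows "polyhedral_cone (down_set_cone I P)"
  unfolding polyhedral_cone_def
proof (intro conjI)
  show "polyhedron (down_set_cone I P)"
    unfolding down_set_cone_def by (rule polyhedron_perm_polyhedron)
  show "cone (down_set_cone I P)"
    unfolding cone_def by (auto simp: mem_down_set_cone[OF pre] mult_nonneg_nonpos)
  have "0 \<in> down_set_cone I P" by (simp add: mem_down_set_cone[OF pre])
  then show "down_set_cone I P \<noteq> {}" by blast
qed

lemma perm_polyhedron_z_upper_eq:
  assumes pre: "preorder_on I P" and u0: "\<And>i. i \<notin> I \<Longrightarrow> u $ i = 0"
    and u: "\<And>A. down_set I P A \<Longrightarrow> ereal (coord_sum u A) = z A"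
  shows "perm_polyhedron I (z_upper I z P) = (+) u ` down_set_cone I P"
proof -
  have "x \<in> perm_polyhedron I (z_upper I z P) \<longleftrightarrow> x - u \<in> down_set_cone I P" for x
  proof -
    have "ereal (coord_sum x A) \<le> z A \<longleftrightarrow> coord_sum (x - u) A \<le> 0"
      "ereal (coord_sum x A) = z A \<longleftrightarrow> coord_sum (x - u) A = 0" if "down_set I P A" for A
      using u[OF that, symmetric] by simp_all
    moreover have "A \<subseteq> I" if "down_set I P A" for A using that unfolding down_set_def by blast
    ultimately show ?thesis
      using down_set_trivial(2)[OF pre] u0
      unfolding mem_down_set_cone[OF pre] mem_perm_polyhedron z_upper_def
      by auto
  qed
  then show ?thesis by (rule translation_eqI)
qed

lemma lineality_z_upper:
  assumes pre: "preorder_on I P" and u0: "\<And>i. i \<notin> I \<Longrightarrow> u $ i = 0"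
    and u: "\<And>A. down_set I P A \<Longrightarrow> ereal (coord_sum u A) = z A"
  shows "lineality_subspace (perm_polyhedron I (z_upper I z P)) =
    {x. (\<forall>i. i \<notin> I \<longrightarrow> x $ i = 0) \<and> (\<forall>A. down_set I P A \<longrightarrow> ereal (coord_sum x A) = z A)}"
    (is "_ = ?L")
proof -
  let ?K = "down_set_cone I P"
  have mem: "y \<in> ?K \<inter> uminus ` ?K \<longleftrightarrow>
      (\<forall>i. i \<notin> I \<longrightarrow> y $ i = 0) \<and> (\<forall>A. down_set I P A \<longrightarrow> coord_sum y A = 0)" for y
  proof -
    have "y \<in> ?K \<inter> uminus ` ?K \<longleftrightarrow> y \<in> ?K \<and> - y \<in> ?K"
      by (auto simp: image_iff) (metis minus_minus)
    then show ?thesis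
      using down_set_trivial(2)[OF pre] by (auto simp: mem_down_set_cone[OF pre] intro: antisym)
  qed
  have "x \<in> ?L \<longleftrightarrow> x - u \<in> ?K \<inter> uminus ` ?K" for x
  proof -
    have "ereal (coord_sum x A) = z A \<longleftrightarrow> coord_sum (x - u) A = 0" if "down_set I P A" for A
      using u[OF that, symmetric] by simp
    then show ?thesis unfolding mem using u0 by auto
  qed
  then have "?L = (+) u ` (?K \<inter> uminus ` ?K)"
    by (rule translation_eqI)
  then show ?thesis
    using lineality_subspace_eq[OF polyhedral_cone_down_set_cone[OF pre]]
      perm_polyhedron_z_upper_eq[OF pre u0 u] by simp
qed

section \<open>Dimension and lineality subspace\<close>

theorem proposition10p9:
  fixes I :: "'i::finite set" and z :: "'i set \<Rightarrow> ereal" and P :: "'i rel"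
  assumes "submodular I z"
    and "preorder_on I P"
    and "conforms I z P"
  shows "translated_cone (perm_polyhedron I (z_upper I z P))
    \<and> aff_dim (perm_polyhedron I (z_upper I z P)) = int (card I) - int (card (components_of I P))
    \<and> aff_dim (perm_polyhedron I z) = aff_dim (perm_polyhedron I (z_upper I z P))
    \<and> perm_polyhedron I (z_lower I z P) face_of perm_polyhedron I z
    \<and> lineality_subspace (perm_polyhedron I (z_upper I z P))
        = affine hull (perm_polyhedron I (z_lower I z P))"
proof -
  note z = assms(1) and pre = assms(2) and conf = assms(3)
  have c: "compatible I z P" using conf unfolding conforms_def by blast
  let ?U = "perm_polyhedron I (z_upper I z P)"
  \<comment> \<open>A point of the face \<open>\<Pi>(z\<^sub>P)\<close> serves as apex: all inequalities of \<open>\<Pi>(z\<^sup>P)\<close> are tight there.\<close>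
  obtain u where "u \<in> perm_polyhedron I (z_lower I z P)"
    using perm_polyhedron_nonempty[OF submodular_z_lower[OF z pre c]] by blast
  then have "u \<in> perm_polyhedron I z" and u: "\<And>A. down_set I P A \<Longrightarrow> ereal (coord_sum u A) = z A"
    unfolding perm_polyhedron_z_lower_eq[OF z pre c] by blast+
  then have u0: "\<And>i. i \<notin> I \<Longrightarrow> u $ i = 0" by (simp add: mem_perm_polyhedron)

  have "translated_cone ?U"
    unfolding translated_cone_def
    using polyhedral_cone_down_set_cone[OF pre] perm_polyhedron_z_upper_eq[OF pre u0 u] by blast
  moreover
  have "affine hull (perm_polyhedron I z) = affine hull ?U"
    unfolding affine_hull_z_upper[OF z pre c] affine_hull_perm_polyhedron[OF z]
    using conforms_decomposes_iff[OF z pre conf] by (metis (no_types, lifting))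
  then have "aff_dim (perm_polyhedron I z) = aff_dim ?U"
    by (rule aff_dim_affine_hull2)
  moreover
  have "aff_dim ?U = int (card I) - int (card (components_of I P))"
  proof -
    let ?W = "{y :: real ^ 'i. (\<forall>i. i \<notin> I \<longrightarrow> y $ i = 0) \<and>
      (\<forall>A. A \<subseteq> I \<and> disconnected_union P I A (I - A) \<longrightarrow> coord_sum y A = 0)}"
    have "x \<in> affine hull ?U \<longleftrightarrow> x - u \<in> ?W" for x
    proof -
      have "ereal (coord_sum x A) = z A \<longleftrightarrow> coord_sum (x - u) A = 0"
        if "A \<subseteq> I \<and> disconnected_union P I A (I - A)" for A
      proof -
        have "down_set I P A" using that disconnected_complement_iff[OF pre] by blast
        from u[OF this, symmetric] show ?thesis by simp
      qed
      then show ?thesis unfolding affine_hull_z_upper[OF z pre c] using u0 by auto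
    qed
    then have hull: "affine hull ?U = (+) u ` ?W" by (rule translation_eqI)
    have "aff_dim ?U = aff_dim ?W"
      using aff_dim_affine_hull[of ?U] unfolding hull aff_dim_translation_eq by (rule sym)
    also have "subspace ?W" by (rule subspaceI) simp_all
    then have "aff_dim ?W = int (dim ?W)" by (rule aff_dim_subspace)
    also note dim_zero_on_disconnected[OF pre]
    finally show ?thesis .
  qed
  moreover
  have "perm_polyhedron I (z_lower I z P) =
      {x \<in> perm_polyhedron I z. \<forall>A. A \<subseteq> I \<and> down_set I P A \<longrightarrow> ereal (coord_sum x A) = z A}"
    unfolding perm_polyhedron_z_lower_eq[OF z pre c] by (auto simp: down_set_def)
  then have "perm_polyhedron I (z_lower I z P) face_of perm_polyhedron I z"
    by (simp only: face_of_tight_sets)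
  moreover
  have "lineality_subspace ?U = affine hull (perm_polyhedron I (z_lower I z P))"
    using lineality_z_upper[OF pre u0 u] affine_hull_z_lower[OF z pre conf] by (rule trans[OF _ sym])
  ultimately show ?thesis by blast
qed

end
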